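(* For any oriented link $L$, $$LG^{3,1}(L;t_0,t_0^{-1}) \overset{\bullet}{=} \Delta_L(t_0)^3 ,$$ where $LG^{3,1}(L;t_0,t_0^{-1})$ is the reduced Links-Gould invariant of $L$, $\Delta_L$ is the Alexander polynomial of $L$, and $\overset{\bullet}{=}$ means equality up to multiplication by a unit of $\mathbb{C}[t_0^{\pm 1}]$.
   Context: $B_n$ is the braid group on $n$ strands with standard Artin generators $\sigma_1,\dots,\sigma_{n-1}$; every oriented link is the closure of some braid. **Alexander polynomial.** Let $W_n$ be the vector space over $\mathbb{C}(t^{\pm 1/2})$ with basis $f_1,\dots,f_n$. The Burau representation $\Psi_{W_n}:B_n\to GL(W_n)$ is given by $\Psi_{W_n}(\sigma_i)(f_i)=(1-t)f_i+t^{1/2}f_{i+1}$, $\Psi_{W_n}(\sigma_i)(f_{i+1})=t^{1/2}f_i$, and $\Psi_{W_n}(\sigma_i)(f_j)=f_j$ for $j\neq i,i+1$. The vector $\delta_n=t^{-(n-1)/2}f_1+t^{-(n-2)/2}f_2+\dots+t^{-1/2}f_{n-1}+f_n$ is fixed by $B_n$; $\Psi_{\widehat{W_n}}$ is the induced representation on $\widehat{W_n}=W_n/\langle\delta_n\rangle$. The Alexander polynomial of $L$ is $\Delta_L(t)\overset{\bullet}{=}\frac{1-t}{1-t^n}\det(I-\Psi_{\widehat{W_n}}(b))$ for any $b\in B_n$ with closure $L$, where $\overset{\bullet}{=}$ means equality up to multiplication by a unit of $\mathbb{C}[t^{\pm1}]$. **The R-matrix $S$.** Let $W$ be an 8-dimensional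 vector space over $\mathbb{C}(t_0^{\pm 1/2})$ with basis $e_1,\dots,e_8$; write $e_{ij}=e_i\otimes e_j$ and $Y=t_0^{1/2}-t_0^{-1/2}$. Put $$A=\begin{pmatrix}0&t_0^{-1/2}\\ t_0^{-1/2}&1-t_0^{-1}\end{pmatrix},\quad B=\begin{pmatrix}0&0&0&1\\0&0&1&Y\\0&1&0&Y\\1&Y&Y&Y^2\end{pmatrix},\quad C=\begin{pmatrix}0&0&0&0&0&0&0&1\\0&0&0&0&0&0&1&Y\\0&0&0&0&0&1&0&Y\\0&0&0&0&1&0&0&Y\\0&0&0&1&0&Y&Y&Y^2\\0&0&1&0&Y&0&Y&Y^2\\0&1&0&0&Y&Y&0&Y^2\\1&Y&Y&Y&Y^2&Y^2&Y^2&Y^3\end{pmatrix}.$$ $S$ is the automorphism of $W\otimes W$ that is the direct sum of the following blocks: - $\mathrm{diag}(1,-t_0^{-1},-t_0^{-1},-t_0^{-1},t_0^{-2},t_0^{-2},t_0^{-2},-t_0^{-3})$ in basis $(e_{11},e_{22},\dots,e_{88})$; - $A$ in bases $(e_{12},e_{21})$, $(e_{13},e_{31})$, $(e_{14},e_{41})$; - $t_0^{-2}A$ in bases $(e_{78},e_{87})$, $(e_{68},e_{86})$, $(e_{58},e_{85})$; - $-t_0^{-1}A$ in bases $(e_{25},e_{52})$, $(e_{35},e_{53})$, $(e_{26},e_{62})$, $(e_{46},e_{64})$, $(e_{37},e_{73})$, $(e_{47},e_{74})$; - $t_0^{-1}B$ in bases $(e_{15},e_{23},e_{32},e_{51})$,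 $(e_{16},e_{24},e_{42},e_{61})$, $(e_{17},e_{34},e_{43},e_{71})$; - $-t_0^{-2}B$ in bases $(e_{48},e_{67},e_{76},e_{84})$, $(e_{38},e_{57},e_{75},e_{83})$, $(e_{28},e_{56},e_{65},e_{82})$; - $t_0^{-3/2}C$ in basis $(e_{18},e_{45},e_{36},e_{27},e_{72},e_{63},e_{54},e_{81})$. $S$ is an R-matrix (a solution of the Yang-Baxter equation), and $b_S^n:B_n\to GL(W^{\otimes n})$ is the representation given by $b_S^n(\sigma_i)=\mathrm{id}_W^{\otimes i-1}\otimes S\otimes \mathrm{id}_W^{\otimes n-i-1}$, $i=1,\dots,n-1$. **Reduced Links-Gould invariant $LG^{3,1}$.** Let $L$ be any oriented link and $b\in B_n$ a braid with closure $L$. The reduced version of the Links-Gould invariant $LG^{3,1}$ is given by $$LG^{3,1}(L;t_0,t_0^{-1})=\tfrac18\,\mathrm{trace}\big((\mathrm{id}_W\otimes\mu^{\otimes n-1})\circ b_S^n(b)\big),\qquad \mu=t_0^{3/2}\,\mathrm{diag}(1,-1,-1,-1,1,1,1,-1)\in\mathrm{End}(W).$$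
   Formalization: With the given S and μ the claim fails for even n (σ_1 in B_2, the unknot, gives t_0^{3/2}); the equality is proved up to units of C[t_0^{±1/2}], and for each braid on n strands up to units of C[t_0^{±1}] after multiplying Δ^3 by t_0^{3(n-1)/2}. *)

theory Defs
  imports
    "HOL-Analysis.Analysis"
    "Jordan_Normal_Form.Determinant"
    "Jordan_Normal_Form.Gauss_Jordan_Elimination"
begin

section \<open>The ground field and equality up to units\<close>

text \<open>The field \<open>\<complex>(t\<^sup>1\<^sup>/\<^sup>2)\<close> is realised as the fraction field of \<open>\<complex>[s]\<close> with
  \<open>s = t\<^sup>1\<^sup>/\<^sup>2\<close>. The variables \<open>t\<close> (Alexander polynomial) and \<open>t\<^sub>0\<close> (Links-Gould invariant) are
  identified from the start.\<close>

type_synonym K = "complex poly fract"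

definition const :: "complex \<Rightarrow> K" where
  "const c = to_fract [:c:]"

definition s :: K where
  "s = to_fract [:0, 1:]"

definition t :: K where
  "t = s ^ 2"

definition Y :: K where
  "Y = s - inverse s"

text \<open>The subring \<open>\<complex>[x\<^sup>\<plusminus>\<^sup>1]\<close>; it is \<open>\<complex>[t\<^sup>\<plusminus>\<^sup>1]\<close> for \<open>x = t\<close> and \<open>\<complex>[t\<^sup>\<plusminus>\<^sup>1\<^sup>/\<^sup>2]\<close> for \<open>x = s\<close>.\<close>

definition laurent_ring :: "K \<Rightarrow> K set" where
  "laurent_ring x = {poly (map_poly const p) x / x ^ k | p k. True}"

definition laurent_unit :: "K \<Rightarrow> K \<Rightarrow> bool" where
  "laurent_unit x u \<longleftrightarrow> u \<in> laurent_ring x \<and> (\<exists>v \<in> laurent_ring x. u * v = 1)"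

definition doteq :: "K \<Rightarrow> K \<Rightarrow> K \<Rightarrow> bool" where
  "doteq x a b \<longleftrightarrow> (\<exists>u. laurent_unit x u \<and> a = u * b)"


section \<open>Braids, oriented links and braid closures\<close>

text \<open>An element of \<open>B\<^sub>n\<close> is given by a word: \<open>(i, True)\<close> stands for \<open>\<sigma>\<^sub>i\<close> and \<open>(i, False)\<close> for
  its inverse, with \<open>1 \<le> i < n\<close>. Products are read from left to right.\<close>

type_synonym braid_word = "(nat \<times> bool) list"

definition is_braid :: "nat \<Rightarrow> braid_word \<Rightarrow> bool" where
  "is_braid n b \<longleftrightarrow> n \<ge> 1 \<and> (\<forall>(i, e) \<in> set b. 1 \<le> i \<and> i < n)"

text \<open>A link is the list of its oriented components, each a 1-periodic regular parametrisation
  of an embedded circle of class \<open>C\<^sup>1\<close> (which excludes wild links).\<close>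

type_synonym link = "(real \<Rightarrow> real^3) list"

definition oriented_link :: "link \<Rightarrow> bool" where
  "oriented_link L \<longleftrightarrow> L \<noteq> [] \<and>
     (\<forall>\<gamma> \<in> set L. \<gamma> C1_differentiable_on UNIV \<and>
        (\<forall>x. vector_derivative \<gamma> (at x) \<noteq> 0) \<and>
        (\<forall>x y. \<gamma> x = \<gamma> y \<longleftrightarrow> x - y \<in> \<int>)) \<and>
     (\<forall>i < length L. \<forall>j < length L. i \<noteq> j \<longrightarrow> range (L ! i) \<inter> range (L ! j) = {})"

definition ambient_isotopy :: "(real \<Rightarrow> real^3 \<Rightarrow> real^3) \<Rightarrow> bool" where
  "ambient_isotopy H \<longleftrightarrow>
     continuous_on ({0..1} \<times> UNIV) (\<lambda>(r, x). H r x) \<and>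
     (\<forall>r \<in> {0..1}. \<exists>G. homeomorphism UNIV UNIV (H r) G) \<and>
     (\<forall>x. H 0 x = x)"

text \<open>The positions in \<open>\<complex>\<close> of the \<open>n\<close> strands during one letter, \<open>u \<in> [0,1]\<close>: the points
  \<open>i\<close> and \<open>i + 1\<close> are exchanged by a half turn about their midpoint.\<close>

definition letter_points :: "nat \<Rightarrow> nat \<times> bool \<Rightarrow> real \<Rightarrow> complex set" where
  "letter_points n l u = (case l of (i, e) \<Rightarrow>
     let c = of_nat i + 1 / 2;
         h = cis (if e then - pi * u else pi * u) / 2
     in of_nat ` ({1..n} - {i, i + 1}) \<union> {c - h, c + h})"

text \<open>The geometric braid of a word of length \<open>m\<close>, extended periodically with period \<open>m + 1\<close>.
  The strands are at rest in the last unit of time, so that the empty word needs no special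
  treatment.\<close>

definition braid_points :: "nat \<Rightarrow> braid_word \<Rightarrow> real \<Rightarrow> complex set" where
  "braid_points n b \<tau> =
     (let k = nat (\<lfloor>\<tau>\<rfloor> mod (int (length b) + 1))
      in if k < length b then letter_points n (b ! k) (frac \<tau>) else of_nat ` {1..n})"

text \<open>The closed braid winds around the third coordinate axis: the point \<open>z\<close> of the braid at
  time \<open>\<tau>\<close> is placed at radius \<open>Re z > 0\<close> and height \<open>Im z\<close> in the half-plane of angle
  \<open>2\<pi>\<tau> / (m + 1)\<close>. For strands directed by increasing angle, the half turn chosen for \<open>\<sigma>\<^sub>i\<close> is
  a positive crossing.\<close>

definition closed_braid_slice :: "nat \<Rightarrow> braid_word \<Rightarrow> real \<Rightarrow> (real^3) set" where
  "closed_braid_slice n b \<tau> =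
     (let \<phi> = 2 * pi * \<tau> / (real (length b) + 1)
      in (\<lambda>z. vector [Re z * cos \<phi>, Re z * sin \<phi>, Im z]) ` braid_points n b \<tau>)"

text \<open>\<open>L\<close> is isotopic to the closure of \<open>b \<in> B\<^sub>n\<close>: an ambient isotopy carries \<open>L\<close> onto the
  closed braid in such a way that every component runs in the direction of the strands, i.e.
  traverses the slices with strictly increasing \<open>\<tau>\<close>.\<close>

definition is_closure_of_braid :: "link \<Rightarrow> nat \<Rightarrow> braid_word \<Rightarrow> bool" where
  "is_closure_of_braid L n b \<longleftrightarrow> is_braid n b \<and>
     (\<exists>H. ambient_isotopy H \<and>
        H 1 ` (\<Union>\<gamma> \<in> set L. range \<gamma>) = (\<Union>\<tau>. closed_braid_slice n b \<tau>) \<and>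
        (\<forall>\<gamma> \<in> set L. \<exists>\<theta>. continuous_on UNIV \<theta> \<and> strict_mono \<theta> \<and>
            (\<forall>x. H 1 (\<gamma> x) \<in> closed_braid_slice n b (\<theta> x))))"


section \<open>Representations of \<open>B\<^sub>n\<close>\<close>

text \<open>The extension to words of an assignment \<open>\<sigma>\<^sub>i \<mapsto> \<rho> i\<close> of invertible \<open>d \<times> d\<close> matrices. Columns
  of matrices are images of basis vectors, and all matrix indices start from 0.\<close>

definition braid_rep :: "nat \<Rightarrow> (nat \<Rightarrow> K mat) \<Rightarrow> braid_word \<Rightarrow> K mat" where
  "braid_rep d \<rho> b =
     foldr (\<lambda>(i, e) M. (if e then \<rho> i else the (mat_inverse (\<rho> i))) * M) b (1\<^sub>m d)"


section \<open>The Alexander polynomial\<close>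

definition burau_gen :: "nat \<Rightarrow> nat \<Rightarrow> K mat" where
  "burau_gen n i = Matrix.mat n n (\<lambda>(r, c).
     if c = i - 1 then (if r = i - 1 then 1 - t else if r = i then s else 0)
     else if c = i then (if r = i - 1 then s else 0)
     else (if r = c then 1 else 0))"

definition burau :: "nat \<Rightarrow> braid_word \<Rightarrow> K mat" where
  "burau n b = braid_rep n (burau_gen n) b"

text \<open>As \<open>\<delta>\<^sub>n\<close> has \<open>f\<^sub>n\<close>-coefficient 1, the classes of \<open>f\<^sub>1, \<dots>, f\<^sub>n\<^sub>-\<^sub>1\<close> form a basis of
  \<open>W\<^sub>n / \<langle>\<delta>\<^sub>n\<rangle>\<close>. In this basis \<open>quot_proj n\<close> is the quotient map (it sends \<open>f\<^sub>n\<close> to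
  \<open>- (\<Sum>i<n. t\<^sup>-\<^sup>(\<^sup>n\<^sup>-\<^sup>i\<^sup>)\<^sup>/\<^sup>2 f\<^sub>i)\<close>) and \<open>quot_lift n\<close> is the section sending the class of \<open>f\<^sub>i\<close> to
  \<open>f\<^sub>i\<close>; since the Burau matrices fix \<open>\<delta>\<^sub>n\<close>, \<open>burau_quot n b\<close> is the induced map.\<close>

definition quot_proj :: "nat \<Rightarrow> K mat" where
  "quot_proj n = Matrix.mat (n - 1) n (\<lambda>(r, c).
     if c = n - 1 then - (inverse s ^ (n - 1 - r)) else if r = c then 1 else 0)"

definition quot_lift :: "nat \<Rightarrow> K mat" where
  "quot_lift n = Matrix.mat n (n - 1) (\<lambda>(r, c). if r = c then 1 else 0)"

definition burau_quot :: "nat \<Rightarrow> braid_word \<Rightarrow> K mat" where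
  "burau_quot n b = quot_proj n * burau n b * quot_lift n"

definition alexander_of_braid :: "nat \<Rightarrow> braid_word \<Rightarrow> K" where
  "alexander_of_braid n b =
     (1 - t) / (1 - t ^ n) * Determinant.det (1\<^sub>m (n - 1) - burau_quot n b)"

definition is_alexander_polynomial :: "link \<Rightarrow> K \<Rightarrow> bool" where
  "is_alexander_polynomial L D \<longleftrightarrow>
     (\<forall>n b. is_closure_of_braid L n b \<longrightarrow> doteq t D (alexander_of_braid n b))"


section \<open>The R-matrix \<open>S\<close>\<close>

definition diag_mat_of :: "K list \<Rightarrow> K mat" where
  "diag_mat_of xs = Matrix.mat (length xs) (length xs) (\<lambda>(r, c). if r = c then xs ! r else 0)"

definition matA :: "K mat" where
  "matA = mat_of_rows_list 2
     [[0, inverse s],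
      [inverse s, 1 - inverse t]]"

definition matB :: "K mat" where
  "matB = mat_of_rows_list 4
     [[0, 0, 0, 1],
      [0, 0, 1, Y],
      [0, 1, 0, Y],
      [1, Y, Y, Y^2]]"

definition matC :: "K mat" where
  "matC = mat_of_rows_list 8
     [[0, 0, 0, 0, 0, 0, 0, 1],
      [0, 0, 0, 0, 0, 0, 1, Y],
      [0, 0, 0, 0, 0, 1, 0, Y],
      [0, 0, 0, 0, 1, 0, 0, Y],
      [0, 0, 0, 1, 0, Y, Y, Y^2],
      [0, 0, 1, 0, Y, 0, Y, Y^2],
      [0, 1, 0, 0, Y, Y, 0, Y^2],
      [1, Y, Y, Y, Y^2, Y^2, Y^2, Y^3]]"

definition matD :: "K mat" where
  "matD = diag_mat_of [1, - inverse t, - inverse t, - inverse t,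
     inverse t ^ 2, inverse t ^ 2, inverse t ^ 2, - (inverse t ^ 3)]"

text \<open>A block is a matrix together with the list of pairs \<open>(i, j)\<close> indexing its basis vectors
  \<open>e\<^sub>i \<otimes> e\<^sub>j\<close>, \<open>1 \<le> i, j \<le> 8\<close>.\<close>

definition S_blocks :: "(K mat \<times> (nat \<times> nat) list) list" where
  "S_blocks =
    [(matD, [(1,1), (2,2), (3,3), (4,4), (5,5), (6,6), (7,7), (8,8)])] @
    map (\<lambda>bs. (matA, bs))
      [[(1,2), (2,1)], [(1,3), (3,1)], [(1,4), (4,1)]] @
    map (\<lambda>bs. (inverse t ^ 2 \<cdot>\<^sub>m matA, bs))
      [[(7,8), (8,7)], [(6,8), (8,6)], [(5,8), (8,5)]] @
    map (\<lambda>bs. (- inverse t \<cdot>\<^sub>m matA, bs))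
      [[(2,5), (5,2)], [(3,5), (5,3)], [(2,6), (6,2)],
       [(4,6), (6,4)], [(3,7), (7,3)], [(4,7), (7,4)]] @
    map (\<lambda>bs. (inverse t \<cdot>\<^sub>m matB, bs))
      [[(1,5), (2,3), (3,2), (5,1)],
       [(1,6), (2,4), (4,2), (6,1)],
       [(1,7), (3,4), (4,3), (7,1)]] @
    map (\<lambda>bs. (- (inverse t ^ 2) \<cdot>\<^sub>m matB, bs))
      [[(4,8), (6,7), (7,6), (8,4)],
       [(3,8), (5,7), (7,5), (8,3)],
       [(2,8), (5,6), (6,5), (8,2)]] @
    [(inverse s ^ 3 \<cdot>\<^sub>m matC,
       [(1,8), (4,5), (3,6), (2,7), (7,2), (6,3), (5,4), (8,1)])]"

text \<open>Position of \<open>e\<^sub>i \<otimes> e\<^sub>j\<close> in the lexicographically ordered basis of \<open>W \<otimes> W\<close>, as in \<open>kron\<close>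
  below.\<close>

definition tensor_index :: "nat \<times> nat \<Rightarrow> nat" where
  "tensor_index = (\<lambda>(i, j). 8 * (i - 1) + (j - 1))"

definition S_mat :: "K mat" where
  "S_mat = Matrix.mat 64 64 (\<lambda>(r, c).
     \<Sum>(M, bs) \<leftarrow> S_blocks. \<Sum>p < length bs. \<Sum>q < length bs.
       if r = tensor_index (bs ! p) \<and> c = tensor_index (bs ! q) then M $$ (p, q) else 0)"


section \<open>The reduced Links-Gould invariant\<close>

definition kron :: "K mat \<Rightarrow> K mat \<Rightarrow> K mat" where
  "kron M N = Matrix.mat (dim_row M * dim_row N) (dim_col M * dim_col N) (\<lambda>(r, c).
     M $$ (r div dim_row N, c div dim_col N) * N $$ (r mod dim_row N, c mod dim_col N))"

primrec kron_power :: "K mat \<Rightarrow> nat \<Rightarrow> K mat" where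
  "kron_power M 0 = 1\<^sub>m 1"
| "kron_power M (Suc k) = kron M (kron_power M k)"

definition mat_trace :: "K mat \<Rightarrow> K" where
  "mat_trace M = (\<Sum>i < dim_row M. M $$ (i, i))"

definition S_rep_gen :: "nat \<Rightarrow> nat \<Rightarrow> K mat" where
  "S_rep_gen n i = kron (kron (1\<^sub>m (8 ^ (i - 1))) S_mat) (1\<^sub>m (8 ^ (n - i - 1)))"

definition S_rep :: "nat \<Rightarrow> braid_word \<Rightarrow> K mat" where
  "S_rep n b = braid_rep (8 ^ n) (S_rep_gen n) b"

definition mu :: "K mat" where
  "mu = s ^ 3 \<cdot>\<^sub>m diag_mat_of [1, -1, -1, -1, 1, 1, 1, -1]"

definition reduced_LG31_of_braid :: "nat \<Rightarrow> braid_word \<Rightarrow> K" where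
  "reduced_LG31_of_braid n b =
     1 / 8 * mat_trace (kron (1\<^sub>m 8) (kron_power mu (n - 1)) * S_rep n b)"

text \<open>The normalisation of \<open>S\<close> and \<open>\<mu>\<close> is not the one invariant under stabilisation: the unknot,
  for example, is the closure of \<open>1 \<in> B\<^sub>1\<close> and of \<open>\<sigma>\<^sub>1 \<in> B\<^sub>2\<close>, with values \<open>1\<close> and \<open>t\<^sup>3\<^sup>/\<^sup>2\<close>. Hence
  the value at a link is a relation, to be read up to units of \<open>\<complex>[t\<^sup>\<plusminus>\<^sup>1\<^sup>/\<^sup>2]\<close>, i.e. up to
  \<open>doteq s\<close>. The half-integral power comes only from \<open>\<mu>\<close>: the value at \<open>b \<in> B\<^sub>n\<close> is in
  \<open>s\<^sup>3\<^sup>(\<^sup>n\<^sup>-\<^sup>1\<^sup>) \<complex>(t)\<close>. On \<open>\<complex>(t)\<close>, \<open>doteq s\<close> and \<open>doteq t\<close> coincide.\<close>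

definition is_reduced_LG31 :: "link \<Rightarrow> K \<Rightarrow> bool" where
  "is_reduced_LG31 L p \<longleftrightarrow>
     (\<exists>n b. is_closure_of_braid L n b \<and> p = reduced_LG31_of_braid n b)"

end

theory Submission
  imports Defs "Jordan_Normal_Form.Char_Poly"
begin

text \<open>
  Only the braid matters: both sides of the second claim are functions of a braid word, and the
  identity between them holds for every word. The first claim follows by replacing the value at a
  braid by \<open>D\<close>, at the price of a unit.

  The eight basis vectors of \<open>W\<close> are the subsets of a set of three colours,
  \<open>e\<^sub>1, \<dots>, e\<^sub>8 = {}, a, b, c, ab, ac, bc, abc\<close>. With this labelling every entry of \<open>S\<close> is a product
  over the colours (\<open>S_entry\<close>): \<open>S\<close> is, up to the order of the tensor factors, the triple tensor
  power of a \<open>4 \<times> 4\<close> matrix. That matrix is the exterior algebra of the \<open>2 \<times> 2\<close> Burau block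
  at the parameter \<open>t\<^sup>-\<^sup>1\<close>. Hence \<open>W\<^sup>\<otimes>\<^sup>n\<close> is the triple tensor power of the exterior algebra of an
  \<open>n\<close>-dimensional space, a basis vector being three subsets of the set of strands, and the braid acts
  by the exterior powers of its Burau matrix \<open>N\<close> at \<open>t\<^sup>-\<^sup>1\<close>; the matrix entries are minors of \<open>N\<close>
  (\<open>S_rep_eq_three_exterior\<close>).

  The weight \<open>id \<otimes> \<mu>\<^sup>\<otimes>\<^sup>(\<^sup>n\<^sup>-\<^sup>1\<^sup>)\<close> contributes \<open>s\<^sup>3\<^sup>(\<^sup>n\<^sup>-\<^sup>1\<^sup>)\<close> and a sign \<open>-1\<close> for every colour
  on every strand but the first. The trace is therefore the cube of a signed sum of principal minors,
  and such a sum is \<open>det(1 + G N)\<close> with \<open>G = diag(1, -1, \<dots>, -1)\<close> (\<open>trace_three_exterior\<close>).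

  It remains to compare \<open>det(1 + G N)\<close> with the Alexander polynomial, which is defined by the Burau
  matrix \<open>M\<close> at \<open>t\<close>. A unitriangular matrix conjugates \<open>N\<close> to the inverse transpose of \<open>M\<close>
  (\<open>burau_duality_intertwines\<close>); it is the matrix of an invariant sesquilinear form of the kind
  found by Squier, and it takes the place of the symmetry of the Alexander polynomial under
  \<open>t \<mapsto> t\<^sup>-\<^sup>1\<close>. After this conjugation \<open>1 + G N\<close> becomes, up to a factor of determinant \<open>\<plusminus> t\<^sup>k\<close>, a
  rank-one perturbation of \<open>1 - M\<^sup>T\<close>. Since \<open>1 - M\<close> is annihilated from both sides by \<open>\<delta>\<^sub>n\<close>, all such
  perturbations have determinants proportional to one minor (\<open>det_corank_one_plus_rank_one\<close>). The
  determinant on the quotient by \<open>\<delta>\<^sub>n\<close> is a multiple of the same minor (\<open>alexander_eq_corner_minor\<close>).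
\<close>

section \<open>Rank-one perturbations of determinants\<close>

lemma mult_mat_index:
  assumes "A \<in> carrier_mat n k" "B \<in> carrier_mat k m" "i < n" "j < m"
  shows "(A * B) $$ (i, j) = (\<Sum>l<k. A $$ (i, l) * B $$ (l, j))"
  using assms by (auto simp: scalar_prod_def atLeast0LessThan intro!: sum.cong)

lemma det_bordered_one:
  fixes a b :: "nat \<Rightarrow> 'a :: idom"
  shows "Determinant.det (four_block_mat (1\<^sub>m m) (Matrix.mat m 1 (\<lambda>(r, _). a r))
      (Matrix.mat 1 m (\<lambda>(_, c). b c)) (Matrix.mat 1 1 (\<lambda>_. x))) = x - (\<Sum>i<m. b i * a i)"
proof -
  let ?L = "four_block_mat (1\<^sub>m m) (0\<^sub>m m 1) (Matrix.mat 1 m (\<lambda>(_, c). b c)) (1\<^sub>m 1)"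
  let ?U = "four_block_mat (1\<^sub>m m) (Matrix.mat m 1 (\<lambda>(r, _). a r)) (0\<^sub>m 1 m)
    (Matrix.mat 1 1 (\<lambda>_. x - (\<Sum>i<m. b i * a i)))"
  have "four_block_mat (1\<^sub>m m) (Matrix.mat m 1 (\<lambda>(r, _). a r))
      (Matrix.mat 1 m (\<lambda>(_, c). b c)) (Matrix.mat 1 1 (\<lambda>_. x)) = ?L * ?U"
    by (subst mult_four_block_mat[of _ m m _ 1 _ 1])
       (auto intro!: cong_four_block_mat eq_matI simp: scalar_prod_def atLeast0LessThan)
  moreover have "Determinant.det ?L = 1"
    by (subst det_four_block_mat_upper_right_zero[of _ m _ 1]) auto
  moreover have "Determinant.det ?U = x - (\<Sum>i<m. b i * a i)"
    by (subst det_four_block_mat_lower_left_zero[of _ m _ 1]) (auto simp: det_single)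
  moreover have "Determinant.det (?L * ?U) = Determinant.det ?L * Determinant.det ?U"
    by (rule det_mult[of _ "m + 1"]) auto
  ultimately show ?thesis
    by simp
qed

text \<open>The bordered matrix with lower right entry 1 and lower row \<open>-b\<close> can be eliminated from
  either corner; one way gives \<open>1 + b \<cdot> a\<close>, the other the determinant of \<open>1 + a b\<^sup>T\<close>.\<close>

lemma det_one_plus_rank_one:
  fixes a b :: "nat \<Rightarrow> 'a :: idom"
  shows "Determinant.det (Matrix.mat m m (\<lambda>(r, c). (if r = c then 1 else 0) + a r * b c))
    = 1 + (\<Sum>i<m. a i * b i)"
proof -
  let ?I = "Matrix.mat m m (\<lambda>(r, c). (if r = c then 1 else 0) + a r * b c)"
  let ?U = "four_block_mat ?I (Matrix.mat m 1 (\<lambda>(r, _). a r)) (0\<^sub>m 1 m) (1\<^sub>m 1)"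
  let ?L = "four_block_mat (1\<^sub>m m) (0\<^sub>m m 1) (Matrix.mat 1 m (\<lambda>(_, c). - b c)) (1\<^sub>m 1)"
  have "four_block_mat (1\<^sub>m m) (Matrix.mat m 1 (\<lambda>(r, _). a r))
      (Matrix.mat 1 m (\<lambda>(_, c). - b c)) (Matrix.mat 1 1 (\<lambda>_. 1)) = ?U * ?L"
    by (subst mult_four_block_mat[of _ m m _ 1 _ 1])
       (auto intro!: cong_four_block_mat eq_matI simp: scalar_prod_def atLeast0LessThan)
  moreover have "Determinant.det ?L = 1"
    by (subst det_four_block_mat_upper_right_zero[of _ m _ 1]) auto
  moreover have "Determinant.det ?U = Determinant.det ?I"
    by (subst det_four_block_mat_lower_left_zero[of _ m _ 1]) auto
  moreover have "Determinant.det (?U * ?L) = Determinant.det ?U * Determinant.det ?L"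
    by (rule det_mult[of _ "m + 1"]) auto
  ultimately show ?thesis
    using det_bordered_one[of m a "\<lambda>c. - b c" 1]
    by (simp add: sum_negf mult.commute)
qed

text \<open>Since \<open>d\<close> has last entry 1, the relations on rows and columns recover \<open>X\<close> from its upper left
  block \<open>X'\<close>: it is the product of \<open>X'\<close> with two bordered identity matrices. Adding \<open>u v\<^sup>T\<close> only puts
  \<open>u\<close> and \<open>v\<close> into the borders, so the determinant splits into three factors.\<close>

lemma det_corank_one_plus_rank_one:
  fixes X :: "'a :: idom mat"
  assumes X: "X \<in> carrier_mat (Suc m) (Suc m)" and d: "d m = 1"
    and right: "\<And>r. r \<le> m \<Longrightarrow> (\<Sum>c\<le>m. X $$ (r, c) * d c) = 0"
    and left: "\<And>c. c \<le> m \<Longrightarrow> (\<Sum>r\<le>m. d r * X $$ (r, c)) = 0"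
  shows "Determinant.det (Matrix.mat (Suc m) (Suc m) (\<lambda>(r, c). X $$ (r, c) + u r * v c))
    = (\<Sum>r\<le>m. d r * u r) * (\<Sum>c\<le>m. d c * v c) * Determinant.det (Matrix.mat m m (\<lambda>(r, c). X $$ (r, c)))"
proof -
  have split: "sum g {..m} = sum g {..<m} + g m" for g :: "nat \<Rightarrow> 'a"
    by (simp add: lessThan_Suc_atMost[symmetric])
  have col: "X $$ (r, m) = - (\<Sum>c<m. X $$ (r, c) * d c)" if "r \<le> m" for r
    using right[OF that] d by (simp add: split eq_neg_iff_add_eq_0 add.commute)
  have row: "X $$ (m, c) = - (\<Sum>r<m. d r * X $$ (r, c))" if "c \<le> m" for c
    using left[OF that] d by (simp add: split eq_neg_iff_add_eq_0 add.commute)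
  let ?X = "Matrix.mat m m (\<lambda>(r, c). X $$ (r, c))"
  let ?U = "four_block_mat (1\<^sub>m m) (Matrix.mat m 1 (\<lambda>(r, _). u r))
      (Matrix.mat 1 m (\<lambda>(_, c). - d c)) (Matrix.mat 1 1 (\<lambda>_. u m))"
  let ?V = "four_block_mat (1\<^sub>m m) (Matrix.mat m 1 (\<lambda>(r, _). - d r))
      (Matrix.mat 1 m (\<lambda>(_, c). v c)) (Matrix.mat 1 1 (\<lambda>_. v m))"
  let ?D = "four_block_mat ?X (0\<^sub>m m 1) (0\<^sub>m 1 m) (1\<^sub>m 1)"
  have "?D * ?V = four_block_mat ?X (Matrix.mat m 1 (\<lambda>(r, _). X $$ (r, m)))
      (Matrix.mat 1 m (\<lambda>(_, c). v c)) (Matrix.mat 1 1 (\<lambda>_. v m))"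
    by (subst mult_four_block_mat[of _ m m _ 1 _ 1])
       (auto intro!: cong_four_block_mat eq_matI simp: scalar_prod_def atLeast0LessThan col sum_negf)
  then have "?U * (?D * ?V) = four_block_mat
      (Matrix.mat m m (\<lambda>(r, c). X $$ (r, c) + u r * v c))
      (Matrix.mat m 1 (\<lambda>(r, _). X $$ (r, m) + u r * v m))
      (Matrix.mat 1 m (\<lambda>(_, c). X $$ (m, c) + u m * v c))
      (Matrix.mat 1 1 (\<lambda>_. X $$ (m, m) + u m * v m))"
    apply (simp only:)
    by (subst mult_four_block_mat[of _ m m _ 1 _ 1])
       (auto intro!: cong_four_block_mat eq_matI simp: scalar_prod_def atLeast0LessThan row sum_negf)
  also have "\<dots> = Matrix.mat (Suc m) (Suc m) (\<lambda>(r, c). X $$ (r, c) + u r * v c)"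
    by (rule eq_matI) (auto simp: less_Suc_eq)
  finally have "Determinant.det (Matrix.mat (Suc m) (Suc m) (\<lambda>(r, c). X $$ (r, c) + u r * v c))
    = Determinant.det (?U * (?D * ?V))" by simp
  also have "\<dots> = Determinant.det ?U * (Determinant.det ?D * Determinant.det ?V)"
    by (subst det_mult[of _ "m + 1"], (auto)[2], subst det_mult[of _ "m + 1"]) auto
  also have "Determinant.det ?D = Determinant.det ?X"
    by (subst det_four_block_mat_lower_left_zero[of _ m _ 1]) auto
  finally show ?thesis
    unfolding det_bordered_one by (simp add: split d sum_negf algebra_simps)
qed

section \<open>Minors and the exterior algebra\<close>

text \<open>A determinant given by a list of row functions and a list of column labels. Keeping the rows in
  a list makes row operations on minors visible as list operations; lists of different lengths give 0,
  so that minors may be indexed by pairs of arbitrary sets.\<close>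

definition det_rows :: "(nat \<Rightarrow> 'a :: comm_ring_1) list \<Rightarrow> nat list \<Rightarrow> 'a" where
  "det_rows fs bs = (if length fs = length bs
     then Determinant.det (Matrix.mat (length bs) (length bs) (\<lambda>(i, j). (fs ! i) (bs ! j))) else 0)"

lemma det_rows_linear:
  "det_rows (L @ (\<lambda>j. x * f j + y * g j) # U) bs
    = x * det_rows (L @ f # U) bs + y * det_rows (L @ g # U) bs"
proof (cases "length L + Suc (length U) = length bs")
  case True
  define m where "m = length bs"
  let ?M = "\<lambda>h. Matrix.mat m m (\<lambda>(i, j). ((L @ h # U) ! i) (bs ! j))"
  have del: "i < length L \<Longrightarrow> (L @ h # U) ! i = (L @ U) ! i"
    "\<not> i < length L \<Longrightarrow> (L @ h # U) ! Suc i = (L @ U) ! i" for h i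
    by (simp_all add: nth_append Suc_diff_le)
  have cof: "cofactor (?M h) (length L) j = cofactor (?M f) (length L) j" if "j < m" for h j
  proof -
    have "mat_delete (?M h) (length L) j = Matrix.mat (m - 1) (m - 1)
        (\<lambda>(i, k). ((L @ U) ! i) (bs ! (if k < j then k else Suc k)))" for h
      unfolding mat_delete_def using that True
      by (intro eq_matI) (simp_all add: del m_def)
    then show ?thesis unfolding cofactor_def by simp
  qed
  have "det_rows (L @ h # U) bs = (\<Sum>j<m. h (bs ! j) * cofactor (?M f) (length L) j)" for h
  proof -
    have "det_rows (L @ h # U) bs = Determinant.det (?M h)"
      using True by (simp add: det_rows_def m_def)
    also have "\<dots> = (\<Sum>j<m. ?M h $$ (length L, j) * cofactor (?M h) (length L) j)"
      using True by (intro laplace_expansion_row) (simp_all add: m_def)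
    also have "\<dots> = (\<Sum>j<m. h (bs ! j) * cofactor (?M f) (length L) j)"
    proof (rule sum.cong)
      fix j assume "j \<in> {..<m}"
      then show "?M h $$ (length L, j) * cofactor (?M h) (length L) j = h (bs ! j) * cofactor (?M f) (length L) j"
        using True cof[of j h] by (simp add: m_def)
    qed simp
    finally show ?thesis .
  qed
  then show ?thesis
    by (simp only: distrib_right sum.distrib sum_distrib_left mult.assoc)
next
  case False
  then show ?thesis by (simp add: det_rows_def)
qed

lemma det_rows_repeated: "det_rows (L @ f # f # U) bs = 0"
proof (cases "length L + Suc (Suc (length U)) = length bs")
  case True
  then show ?thesis
    unfolding det_rows_def
    by (auto intro!: det_identical_rows[of _ "length bs" "length L" "Suc (length L)"]
        simp: nth_append Matrix.row_def)
next
  case False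
  then show ?thesis by (simp add: det_rows_def)
qed

lemma det_rows_swap: "det_rows (L @ g # f # U) bs = - det_rows (L @ f # g # U) bs"
proof -
  have lin: "det_rows (L @ (\<lambda>j. f j + g j) # V) bs
      = det_rows (L @ f # V) bs + det_rows (L @ g # V) bs" for L f g V
    using det_rows_linear[of L 1 f 1 g V bs] by simp
  have "0 = det_rows (L @ (\<lambda>j. f j + g j) # (\<lambda>j. f j + g j) # U) bs"
    by (simp only: det_rows_repeated)
  also have "\<dots> = det_rows ((L @ [f]) @ (\<lambda>j. f j + g j) # U) bs
      + det_rows ((L @ [g]) @ (\<lambda>j. f j + g j) # U) bs"
    by (simp only: lin append_assoc append_Cons append_Nil)
  also have "\<dots> = det_rows (L @ f # g # U) bs + det_rows (L @ g # f # U) bs"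
    by (simp only: lin) (simp add: det_rows_repeated)
  finally show ?thesis by (simp add: eq_neg_iff_add_eq_0 add.commute)
qed

text \<open>As a matrix indexed by subsets, this is the exterior algebra of \<open>M\<close>.\<close>

definition minor :: "'a :: comm_ring_1 mat \<Rightarrow> nat set \<Rightarrow> nat set \<Rightarrow> 'a" where
  "minor M A B = det_rows (map (\<lambda>i j. M $$ (i, j)) (filter (\<lambda>i. i \<in> A) [0..<dim_row M]))
     (filter (\<lambda>j. j \<in> B) [0..<dim_col M])"

text \<open>The exterior algebra of the \<open>2 \<times> 2\<close> matrix with rows \<open>(z, w)\<close> and \<open>(w, 0)\<close>. The Boolean pairs
  tell which of two neighbouring strands are occupied, in the output \<open>x\<close> and in the input \<open>y\<close>.\<close>

definition local_weight :: "'a :: comm_ring_1 \<Rightarrow> 'a \<Rightarrow> bool \<times> bool \<Rightarrow> bool \<times> bool \<Rightarrow> 'a" where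
  "local_weight w z x y =
     (if x = y then (if x = (True, True) then - (w ^ 2) else if x = (True, False) then z
                     else if x = (False, True) then 0 else 1)
      else if x = prod.swap y then w else 0)"

text \<open>The exterior algebra of \<open>local_mat w z n i\<close>, indexed by sets of strands.\<close>

definition exterior_local :: "'a :: comm_ring_1 \<Rightarrow> 'a \<Rightarrow> nat \<Rightarrow> nat set \<Rightarrow> nat set \<Rightarrow> 'a" where
  "exterior_local w z i A C = (if A - {i, Suc i} = C - {i, Suc i}
     then local_weight w z (i \<in> A, Suc i \<in> A) (i \<in> C, Suc i \<in> C) else 0)"

definition two_strand_mat :: "'a :: comm_ring_1 \<Rightarrow> 'a \<Rightarrow> 'a \<Rightarrow> 'a \<Rightarrow> nat \<Rightarrow> nat \<Rightarrow> 'a mat" where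
  "two_strand_mat a b a' b' n i = Matrix.mat n n (\<lambda>(r, c).
     if r = i then (if c = i then a else if c = Suc i then b else 0)
     else if r = Suc i then (if c = i then a' else if c = Suc i then b' else 0)
     else if r = c then 1 else 0)"

lemma two_strand_mat_carrier [simp]: "two_strand_mat a b a' b' n i \<in> carrier_mat n n"
  by (simp add: two_strand_mat_def)

lemma two_strand_mat_dim [simp]:
  "dim_row (two_strand_mat a b a' b' n i) = n" "dim_col (two_strand_mat a b a' b' n i) = n"
  by (simp_all add: two_strand_mat_def)

lemma two_strand_mat_mult_index:
  assumes M: "M \<in> carrier_mat n m" and i: "Suc i < n" and r: "r < n" and c: "c < m"
  shows "(two_strand_mat a b a' b' n i * M) $$ (r, c) =
    (if r = i then a * M $$ (i, c) + b * M $$ (Suc i, c)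
     else if r = Suc i then a' * M $$ (i, c) + b' * M $$ (Suc i, c) else M $$ (r, c))"
proof -
  let ?T = "two_strand_mat a b a' b' n i"
  have "(?T * M) $$ (r, c) = (\<Sum>k<n. ?T $$ (r, k) * M $$ (k, c))"
    using M r c by (auto simp: scalar_prod_def atLeast0LessThan intro!: sum.cong)
  also have "\<dots> = (\<Sum>k\<in>{r, i, Suc i}. ?T $$ (r, k) * M $$ (k, c))"
    by (rule sum.mono_neutral_right) (use r i in \<open>auto simp: two_strand_mat_def\<close>)
  also have "\<dots> = (if r = i then a * M $$ (i, c) + b * M $$ (Suc i, c)
     else if r = Suc i then a' * M $$ (i, c) + b' * M $$ (Suc i, c) else M $$ (r, c))"
    using r i by (auto simp: two_strand_mat_def add.commute insert_commute[of "Suc i" i])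
  finally show ?thesis .
qed

lemma mult_two_strand_mat_index:
  assumes M: "M \<in> carrier_mat m n" and i: "Suc i < n" and r: "r < m" and c: "c < n"
  shows "(M * two_strand_mat a b a' b' n i) $$ (r, c) =
    (if c = i then M $$ (r, i) * a + M $$ (r, Suc i) * a'
     else if c = Suc i then M $$ (r, i) * b + M $$ (r, Suc i) * b' else M $$ (r, c))"
proof -
  let ?T = "two_strand_mat a b a' b' n i"
  have "(M * ?T) $$ (r, c) = (\<Sum>k<n. M $$ (r, k) * ?T $$ (k, c))"
    using M r c by (auto simp: scalar_prod_def atLeast0LessThan intro!: sum.cong)
  also have "\<dots> = (\<Sum>k\<in>{c, i, Suc i}. M $$ (r, k) * ?T $$ (k, c))"
    by (rule sum.mono_neutral_right) (use c i in \<open>auto simp: two_strand_mat_def\<close>)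
  also have "\<dots> = (if c = i then M $$ (r, i) * a + M $$ (r, Suc i) * a'
     else if c = Suc i then M $$ (r, i) * b + M $$ (r, Suc i) * b' else M $$ (r, c))"
    using c i by (auto simp: two_strand_mat_def add.commute insert_commute[of "Suc i" i])
  finally show ?thesis .
qed

lemma two_strand_mat_mult:
  assumes i: "Suc i < n"
  shows "two_strand_mat a b a' b' n i * two_strand_mat c d c' d' n i
    = two_strand_mat (a * c + b * c') (a * d + b * d') (a' * c + b' * c') (a' * d + b' * d') n i"
proof (rule eq_matI)
  fix p q
  assume "p < dim_row (two_strand_mat (a * c + b * c') (a * d + b * d') (a' * c + b' * c') (a' * d + b' * d') n i)"
    "q < dim_col (two_strand_mat (a * c + b * c') (a * d + b * d') (a' * c + b' * c') (a' * d + b' * d') n i)"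
  then have pq: "p < n" "q < n" by simp_all
  show "(two_strand_mat a b a' b' n i * two_strand_mat c d c' d' n i) $$ (p, q)
    = two_strand_mat (a * c + b * c') (a * d + b * d') (a' * c + b' * c') (a' * d + b' * d') n i $$ (p, q)"
    unfolding two_strand_mat_mult_index[OF two_strand_mat_carrier i pq]
    using pq i by (auto simp: two_strand_mat_def)
qed simp_all

lemma two_strand_mat_one: "two_strand_mat 1 0 0 1 n i = 1\<^sub>m n"
  by (rule eq_matI) (auto simp: two_strand_mat_def)

abbreviation local_mat :: "'a :: comm_ring_1 \<Rightarrow> 'a \<Rightarrow> nat \<Rightarrow> nat \<Rightarrow> 'a mat" where
  "local_mat w z \<equiv> two_strand_mat z w w 0"

lemma minor_one:
  assumes "A \<subseteq> {..<n}" "B \<subseteq> {..<n}"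
  shows "minor (1\<^sub>m n) A B = (if A = B then 1 else 0)"
proof -
  define as bs where "as = filter (\<lambda>k. k \<in> A) [0..<n]" and "bs = filter (\<lambda>k. k \<in> B) [0..<n]"
  have set: "set as = A" "distinct as" "set bs = B" "distinct bs"
    using assms by (auto simp: as_def bs_def)
  let ?M = "Matrix.mat (length bs) (length bs) (\<lambda>(p, q). 1\<^sub>m n $$ (as ! p, bs ! q))"
  have minor: "minor (1\<^sub>m n) A B = (if length as = length bs then Determinant.det ?M else 0)"
    unfolding minor_def det_rows_def
    by (auto simp: as_def[symmetric] bs_def[symmetric] intro!: arg_cong[where f = Determinant.det] eq_matI)
  show ?thesis
  proof (cases "A = B")
    case True
    then have eq: "as = bs" by (simp add: as_def bs_def)
    have id: "?M = 1\<^sub>m (length bs)"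
    proof (rule eq_matI)
      fix p q assume "p < dim_row (1\<^sub>m (length bs))" "q < dim_col (1\<^sub>m (length bs))"
      then have pq: "p < length bs" "q < length bs" by auto
      then have "bs ! p < n" "bs ! q < n"
        using set assms nth_mem by blast+
      then show "?M $$ (p, q) = 1\<^sub>m (length bs) $$ (p, q)"
        using pq set by (simp add: eq nth_eq_iff_index_eq)
    qed auto
    show ?thesis
      unfolding minor id using True eq by simp
  next
    case False
    have z: "Determinant.det ?M = 0" if len: "length as = length bs"
    proof -
      have "card A = card B" "finite A" "finite B"
        using len set distinct_card[of as] distinct_card[of bs] by auto
      then have "\<not> A \<subseteq> B"
        using False card_subset_eq by blast
      then obtain p where p: "p < length as" "as ! p \<notin> B"
        using set by (metis in_set_conv_nth subsetI)
      have zero: "?M $$ (p, q) = 0" if "q < length bs" for q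
      proof -
        have "as ! p < n" "bs ! q < n" "as ! p \<noteq> bs ! q"
          using p that set(1,3) assms nth_mem[of q bs] nth_mem[of p as] by auto
        then show ?thesis
          using p len that by simp
      qed
      show ?thesis
        by (subst laplace_expansion_row[of _ "length bs" p]) (use p len in \<open>auto simp: zero simp del: index_mat\<close>)
    qed
    show ?thesis
      unfolding minor using False by (cases "length as = length bs") (simp_all only: z if_True if_False if_cancel)
  qed
qed

lemma upt_split_at:
  assumes "Suc i < n"
  shows "[0..<n] = [0..<i] @ i # Suc i # [Suc (Suc i)..<n]"
  using assms upt_add_eq_append[of 0 i "n - i"] by (simp add: upt_conv_Cons)

lemma det_rows_map_cong:
  assumes "\<And>i j. i \<in> set xs \<Longrightarrow> j \<in> set bs \<Longrightarrow> f i j = g i j"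
  shows "det_rows (map f xs) bs = det_rows (map g xs) bs"
  unfolding det_rows_def using assms
  by (auto intro!: arg_cong[where f = Determinant.det] eq_matI)

text \<open>Multiplication by a matrix that involves two neighbouring strands changes only two adjacent rows,
  so no Cauchy-Binet formula is needed: the minor is expanded by linearity in these rows, and when both
  occur the determinant of the \<open>2 \<times> 2\<close> block splits off. As the rows are adjacent, exchanging one for
  the other never produces a sign.\<close>

lemma minor_local_mat:
  assumes M: "M \<in> carrier_mat n m" and i: "Suc i < n"
  shows "minor (local_mat w z n i * M) A B =
    local_weight w z (i \<in> A, Suc i \<in> A) (i \<in> A, Suc i \<in> A) * minor M A B
    + (if (i \<in> A) \<noteq> (Suc i \<in> A) then w * minor M (Transposition.transpose i (Suc i) ` A) B else 0)"
proof -
  define f where "f = (\<lambda>r j. M $$ (r, j))"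
  define h where "h = (\<lambda>r. if r = i then \<lambda>j. z * f i j + w * f (Suc i) j
     else if r = Suc i then \<lambda>j. w * f i j else f r)"
  define bs where "bs = filter (\<lambda>j. j \<in> B) [0..<m]"
  define L where "L = map f (filter (\<lambda>i. i \<in> A) [0..<i])"
  define U where "U = map f (filter (\<lambda>i. i \<in> A) [Suc (Suc i)..<n])"
  let ?P = "local_mat w z n i * M"
  let ?A = "Transposition.transpose i (Suc i) ` A"
  have dr: "dim_row M = n" "dim_col M = m" using M by auto
  have drP: "dim_row ?P = n" "dim_col ?P = m" using dr by auto
  have split: "det_rows (map g (filter (\<lambda>i. i \<in> C) [0..<n])) bs
     = det_rows (map g (filter (\<lambda>i. i \<in> C) [0..<i])
         @ ((if i \<in> C then [g i] else []) @ (if Suc i \<in> C then [g (Suc i)] else []))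
         @ map g (filter (\<lambda>i. i \<in> C) [Suc (Suc i)..<n])) bs" for g C
    unfolding upt_split_at[OF i] by simp
  have inA: "k \<in> ?A \<longleftrightarrow> k \<in> A" if "k \<noteq> i" "k \<noteq> Suc i" for k
    using that by (simp add: in_transpose_image_iff)
  have iA: "i \<in> ?A \<longleftrightarrow> Suc i \<in> A" "Suc i \<in> ?A \<longleftrightarrow> i \<in> A"
    by (simp_all add: in_transpose_image_iff)
  have LA: "map f (filter (\<lambda>i. i \<in> ?A) [0..<i]) = L"
    unfolding L_def by (intro arg_cong[where f = "map _"] filter_cong) (auto simp: inA)
  have UA: "map f (filter (\<lambda>i. i \<in> ?A) [Suc (Suc i)..<n]) = U"
    unfolding U_def by (intro arg_cong[where f = "map _"] filter_cong) (auto simp: inA)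
  have hL: "map h (filter (\<lambda>i. i \<in> A) [0..<i]) = L"
    unfolding L_def h_def by (intro map_cong) auto
  have hU: "map h (filter (\<lambda>i. i \<in> A) [Suc (Suc i)..<n]) = U"
    unfolding U_def h_def by (intro map_cong) auto
  have "minor ?P A B = det_rows (map h (filter (\<lambda>i. i \<in> A) [0..<n])) bs"
    unfolding minor_def drP bs_def
    by (rule det_rows_map_cong) (auto simp: h_def f_def two_strand_mat_mult_index[OF M i] simp del: index_mult_mat(1))
  also have "\<dots> = det_rows (L @ ((if i \<in> A then [h i] else []) @
      (if Suc i \<in> A then [h (Suc i)] else [])) @ U) bs"
    by (simp only: split hL hU)
  finally have P: "minor ?P A B = \<dots>" .
  have MA: "minor M A B = det_rows (L @ ((if i \<in> A then [f i] else []) @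
      (if Suc i \<in> A then [f (Suc i)] else [])) @ U) bs"
    unfolding minor_def dr f_def[symmetric] bs_def[symmetric] by (simp only: split L_def U_def)
  have MA': "minor M ?A B = det_rows (L @ ((if Suc i \<in> A then [f i] else []) @
      (if i \<in> A then [f (Suc i)] else [])) @ U) bs"
    unfolding minor_def dr f_def[symmetric] bs_def[symmetric] by (simp only: split LA UA iA)
  have scale: "det_rows (V @ (\<lambda>j. x * g j) # U') bs = x * det_rows (V @ g # U') bs" for V x g U'
    using det_rows_linear[of V x g 0 g U' bs] by simp
  have hi: "h i = (\<lambda>j. z * f i j + w * f (Suc i) j)" "h (Suc i) = (\<lambda>j. w * f i j)"
    by (auto simp: h_def)
  show ?thesis
  proof (cases "i \<in> A")
    case iA: True
    show ?thesis
    proof (cases "Suc i \<in> A")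
      case True
      have "minor ?P A B = det_rows ((L @ [h i]) @ (\<lambda>j. w * f i j) # U) bs"
        unfolding P using iA True by (simp add: hi)
      also have "\<dots> = w * det_rows (L @ h i # f i # U) bs"
        by (simp only: scale) simp
      also have "\<dots> = w * (w * det_rows (L @ f (Suc i) # f i # U) bs)"
        by (simp only: hi det_rows_linear det_rows_repeated) simp
      also have "\<dots> = - (w ^ 2) * det_rows (L @ f i # f (Suc i) # U) bs"
        by (simp only: det_rows_swap[of L "f (Suc i)"]) (simp add: power2_eq_square)
      finally show ?thesis
        using iA True unfolding MA by (simp add: local_weight_def)
    next
      case False
      then show ?thesis
        using iA unfolding P MA MA' by (simp add: hi det_rows_linear local_weight_def)
    qed
  next
    case False
    then show ?thesis
      unfolding P MA MA' by (simp add: hi scale local_weight_def)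
  qed
qed

text \<open>Functoriality of the exterior algebra for a product whose left factor is local.\<close>

lemma sum_exterior_local_minor:
  assumes M: "M \<in> carrier_mat n m" and i: "Suc i < n" and A: "A \<subseteq> {..<n}"
  shows "(\<Sum>C\<in>Pow {..<n}. exterior_local w z i A C * minor M C B) = minor (local_mat w z n i * M) A B"
proof -
  let ?A = "Transposition.transpose i (Suc i) ` A"
  have inA: "k \<in> ?A \<longleftrightarrow> k \<in> A" if "k \<noteq> i" "k \<noteq> Suc i" for k
    using that by (simp add: in_transpose_image_iff)
  have iA: "i \<in> ?A \<longleftrightarrow> Suc i \<in> A" "Suc i \<in> ?A \<longleftrightarrow> i \<in> A"
    by (simp_all add: in_transpose_image_iff)
  have A': "?A \<subseteq> {..<n}"
    using A i by (auto simp: Transposition.transpose_def)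
  have same: "?A = A \<longleftrightarrow> (i \<in> A) = (Suc i \<in> A)"
  proof
    assume "(i \<in> A) = (Suc i \<in> A)"
    then have "k \<in> ?A \<longleftrightarrow> k \<in> A" for k
      using inA[of k] iA by (cases "k = i \<or> k = Suc i") auto
    then show "?A = A" by blast
  next
    assume "?A = A"
    then show "(i \<in> A) = (Suc i \<in> A)" using iA(1) by (simp only:)
  qed
  have eqA: "C = A" if "A - {i, Suc i} = C - {i, Suc i}" "i \<in> A \<longleftrightarrow> i \<in> C" "Suc i \<in> A \<longleftrightarrow> Suc i \<in> C" for C
    using that by blast
  have eqA': "C = ?A" if "A - {i, Suc i} = C - {i, Suc i}" "Suc i \<in> A \<longleftrightarrow> i \<in> C" "i \<in> A \<longleftrightarrow> Suc i \<in> C" for C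
  proof (rule Set.set_eqI)
    fix k show "k \<in> C \<longleftrightarrow> k \<in> ?A"
      using that inA[of k] iA by (cases "k = i \<or> k = Suc i") auto
  qed
  have zero: "exterior_local w z i A C = 0" if "C \<noteq> A" "C \<noteq> ?A" for C
  proof (rule ccontr)
    assume nz: "\<not> ?thesis"
    then have off: "A - {i, Suc i} = C - {i, Suc i}"
      unfolding exterior_local_def by presburger
    then have "local_weight w z (i \<in> A, Suc i \<in> A) (i \<in> C, Suc i \<in> C) \<noteq> 0"
      using nz unfolding exterior_local_def by presburger
    then have "(i \<in> A, Suc i \<in> A) = (i \<in> C, Suc i \<in> C) \<or> (i \<in> A, Suc i \<in> A) = prod.swap (i \<in> C, Suc i \<in> C)"
      unfolding local_weight_def by presburger
    then have "C = A \<or> C = ?A"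
      using eqA[OF off] eqA'[OF off] unfolding swap_simp prod.inject by argo
    then show False using that by argo
  qed
  have diff: "?A - {i, Suc i} = A - {i, Suc i}"
    using inA by auto
  have diag: "exterior_local w z i A A = local_weight w z (i \<in> A, Suc i \<in> A) (i \<in> A, Suc i \<in> A)"
    by (simp add: exterior_local_def)
  have off: "exterior_local w z i A ?A = w" if "(i \<in> A) \<noteq> (Suc i \<in> A)"
    unfolding exterior_local_def diff iA using that by (simp add: local_weight_def)
  have "(\<Sum>C\<in>Pow {..<n}. exterior_local w z i A C * minor M C B)
      = (\<Sum>C\<in>{A, ?A}. exterior_local w z i A C * minor M C B)"
  proof (rule sum.mono_neutral_right)
    show "{A, ?A} \<subseteq> Pow {..<n}"
      using A A' by blast
    show "\<forall>C\<in>Pow {..<n} - {A, ?A}. exterior_local w z i A C * minor M C B = 0"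
      using zero by simp
  qed simp
  also have "\<dots> = exterior_local w z i A A * minor M A B
      + (if ?A \<noteq> A then exterior_local w z i A ?A * minor M ?A B else 0)"
  proof (cases "?A = A")
    case True
    then show ?thesis by (simp only: insert_absorb2 refl if_False not_True_eq_False) simp
  next
    case False
    then show ?thesis by (subst sum.insert) auto
  qed
  also have "\<dots> = minor (local_mat w z n i * M) A B"
    unfolding minor_local_mat[OF M i] same diag 
    by (cases "(i \<in> A) = (Suc i \<in> A)") (simp_all only: off not_False_eq_True if_True if_False simp_thms)
  finally show ?thesis .
qed

section \<open>Sums of principal minors\<close>

text \<open>The principal submatrix of \<open>X\<close> on the labels \<open>ks\<close>, with 1 added to the diagonal at the labels in \<open>J\<close>.
  It interpolates between \<open>X\<close> and \<open>1 + X\<close>.\<close>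

definition shifted_principal :: "'a :: comm_ring_1 mat \<Rightarrow> nat set \<Rightarrow> nat list \<Rightarrow> 'a mat" where
  "shifted_principal X J ks = Matrix.mat (length ks) (length ks)
     (\<lambda>(p, q). X $$ (ks ! p, ks ! q) + (if p = q \<and> ks ! p \<in> J then 1 else 0))"

text \<open>Adding 1 at a single diagonal position adds the cofactor of that position.\<close>

lemma det_shifted_principal_insert:
  assumes "distinct (xs @ k # ys)" and "k \<notin> J"
  shows "Determinant.det (shifted_principal X (insert k J) (xs @ k # ys)) =
    Determinant.det (shifted_principal X J (xs @ k # ys))
    + Determinant.det (shifted_principal X J (xs @ ys))"
proof -
  define l where "l = length xs"
  define m where "m = length (xs @ k # ys)"
  let ?ks = "xs @ k # ys"
  let ?A = "shifted_principal X (insert k J) ?ks" and ?B = "shifted_principal X J ?ks"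
  have lm: "l < m" by (simp add: l_def m_def)
  have A: "?A \<in> carrier_mat m m" and B: "?B \<in> carrier_mat m m"
    by (simp_all add: shifted_principal_def m_def)
  have kl: "?ks ! p = k \<longleftrightarrow> p = l" if "p < m" for p
    using nth_eq_iff_index_eq[OF assms(1), of p l] that lm by (simp add: l_def m_def)
  have entry: "?A $$ (p, q) = ?B $$ (p, q) + (if p = l \<and> q = l then 1 else 0)" if "p < m" "q < m" for p q
    using that kl[of p] assms(2) unfolding shifted_principal_def m_def by auto
  have del: "mat_delete ?A l q = mat_delete ?B l q" if "q < m" for q
    unfolding mat_delete_def using A B by (auto intro!: eq_matI simp: entry)
  have "?ks ! (if p < l then p else Suc p) = (xs @ ys) ! p" for p
    by (auto simp: nth_append l_def Suc_diff_le)
  moreover have "mat_delete ?B l l = Matrix.mat (m - 1) (m - 1) (\<lambda>(p, q).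
      X $$ (?ks ! (if p < l then p else Suc p), ?ks ! (if q < l then q else Suc q)) +
        (if p = q \<and> ?ks ! (if p < l then p else Suc p) \<in> J then 1 else 0))"
    unfolding mat_delete_def using B
    by (intro eq_matI) (auto simp: shifted_principal_def m_def[symmetric])
  ultimately have del_l: "mat_delete ?B l l = shifted_principal X J (xs @ ys)"
    by (simp add: shifted_principal_def m_def)
  have "Determinant.det ?A = (\<Sum>q<m. ?A $$ (l, q) * cofactor ?A l q)"
    by (rule laplace_expansion_row[OF A lm])
  also have "\<dots> = (\<Sum>q<m. ?B $$ (l, q) * cofactor ?B l q + (if q = l then cofactor ?B l q else 0))"
    by (intro sum.cong) (auto simp: entry lm cofactor_def del algebra_simps)
  also have "\<dots> = Determinant.det ?B + cofactor ?B l l"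
    using lm by (simp add: sum.distrib laplace_expansion_row[OF B lm])
  also have "cofactor ?B l l = Determinant.det (shifted_principal X J (xs @ ys))"
    by (simp add: cofactor_def del_l neg_one_even_power)
  finally show ?thesis .
qed

text \<open>The expansion of \<open>det(1 + X)\<close> into principal minors, generalised to allow an induction on the set
  of shifted diagonal positions: a label in \<open>J\<close> is either kept unshifted or deleted.\<close>

lemma sum_det_principal:
  assumes "finite J" "distinct ks" "J \<subseteq> set ks"
  shows "(\<Sum>A\<in>Pow J. Determinant.det (shifted_principal X {} (filter (\<lambda>k. k \<notin> J \<or> k \<in> A) ks)))
    = Determinant.det (shifted_principal X J ks)"
  using assms
proof (induction J arbitrary: ks rule: finite_induct)
  case empty
  then show ?case by simp
next
  case (insert k J)
  obtain xs ys where ks: "ks = xs @ k # ys"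
    using insert.prems by (meson insert_subset split_list)
  let ?t = "\<lambda>ks J A. Determinant.det (shifted_principal X {} (filter (\<lambda>k. k \<notin> J \<or> k \<in> A) ks))"
  have kept: "?t ks (insert k J) (insert k A) = ?t ks J A" if "A \<subseteq> J" for A
    using insert.hyps(2) by (intro arg_cong[where f = "\<lambda>l. Determinant.det (shifted_principal X {} l)"] filter_cong) auto
  have dropped: "?t ks (insert k J) A = ?t (xs @ ys) J A" if "A \<subseteq> J" for A
  proof -
    have "k \<notin> A" "k \<notin> set xs" "k \<notin> set ys"
      using that insert.hyps(2) insert.prems(1) ks by auto
    then have "filter (\<lambda>j. j \<notin> insert k J \<or> j \<in> A) ks = filter (\<lambda>j. j \<notin> J \<or> j \<in> A) (xs @ ys)"
      unfolding ks by (auto intro!: arg_cong2[where f = append] filter_cong)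
    then show ?thesis by simp
  qed
  have inj: "inj_on (insert k) (Pow J)"
    using insert.hyps(2) by (auto simp: inj_on_def)
  have disj: "Pow J \<inter> insert k ` Pow J = {}"
    using insert.hyps(2) by auto
  have sub: "J \<subseteq> set ks" "J \<subseteq> set (xs @ ys)"
    using insert.prems insert.hyps(2) ks by auto
  have "(\<Sum>A\<in>Pow (insert k J). ?t ks (insert k J) A)
      = (\<Sum>A\<in>Pow J. ?t ks (insert k J) A) + (\<Sum>A\<in>Pow J. ?t ks (insert k J) (insert k A))"
    unfolding Pow_insert using insert.hyps(1) disj
    by (simp add: sum.union_disjoint sum.reindex[OF inj] o_def)
  also have "\<dots> = (\<Sum>A\<in>Pow J. ?t (xs @ ys) J A) + (\<Sum>A\<in>Pow J. ?t ks J A)"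
    by (intro arg_cong2[where f = "(+)"] sum.cong refl; simp only: Pow_iff kept dropped)
  also have "\<dots> = Determinant.det (shifted_principal X J (xs @ ys)) + Determinant.det (shifted_principal X J ks)"
    using insert.IH[of ks] insert.IH[of "xs @ ys"] insert.prems(1) sub ks by simp
  also have "\<dots> = Determinant.det (shifted_principal X (insert k J) ks)"
    using det_shifted_principal_insert[of xs k ys J X] insert.prems(1) insert.hyps(2) ks
    by (simp add: add.commute)
  finally show ?case .
qed

lemma sum_signed_principal_minors:
  assumes M: "M \<in> carrier_mat n n"
  shows "(\<Sum>A\<in>Pow {..<n}. (\<Prod>k\<in>A. g k) * minor M A A)
    = Determinant.det (Matrix.mat n n (\<lambda>(r, c). (if r = c then 1 else 0) + g r * M $$ (r, c)))"
proof -
  define X where "X = Matrix.mat n n (\<lambda>(r, c). g r * M $$ (r, c))"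
  have "(\<Prod>k\<in>A. g k) * minor M A A = Determinant.det (shifted_principal X {} (filter (\<lambda>k. k \<notin> {..<n} \<or> k \<in> A) [0..<n]))"
    if "A \<subseteq> {..<n}" for A
  proof -
    define ks where "ks = filter (\<lambda>k. k \<in> A) [0..<n]"
    have ks: "filter (\<lambda>k. k \<notin> {..<n} \<or> k \<in> A) [0..<n] = ks"
      unfolding ks_def by (rule filter_cong) auto
    have set_ks: "set ks = A" "distinct ks"
      using that by (auto simp: ks_def)
    let ?M = "Matrix.mat (length ks) (length ks) (\<lambda>(p, q). M $$ (ks ! p, ks ! q))"
    let ?D = "Matrix.mat (length ks) (length ks) (\<lambda>(p, q). if p = q then g (ks ! p) else 0)"
    have a: "minor M A A = Determinant.det ?M"
      unfolding minor_def using M by (auto simp: ks_def[symmetric] det_rows_def intro!: arg_cong[where f = Determinant.det] eq_matI)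
    have b: "Determinant.det ?D = (\<Prod>k\<in>A. g k)"
    proof -
      have "Determinant.det ?D = prod_list (diag_mat ?D)"
        by (rule det_upper_triangular[of _ "length ks"]) auto
      also have "\<dots> = prod_list (map g ks)"
        by (intro arg_cong[where f = prod_list] nth_equalityI) (auto simp: diag_mat_def)
      also have "\<dots> = (\<Prod>k\<in>A. g k)"
        using set_ks prod.distinct_set_conv_list[of ks g] by simp
      finally show ?thesis .
    qed
    have c: "shifted_principal X {} ks = ?D * ?M"
    proof (rule eq_matI)
      fix p q assume "p < dim_row (?D * ?M)" "q < dim_col (?D * ?M)"
      then have pq: "p < length ks" "q < length ks" by auto
      have "(?D * ?M) $$ (p, q) = (\<Sum>l<length ks. if p = l then g (ks ! l) * M $$ (ks ! l, ks ! q) else 0)"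
        using pq by (auto simp: scalar_prod_def atLeast0LessThan if_distrib[of "\<lambda>x. x * _"] cong: if_cong intro!: sum.cong)
      also have "\<dots> = g (ks ! p) * M $$ (ks ! p, ks ! q)"
        using pq by simp
      finally show "shifted_principal X {} ks $$ (p, q) = (?D * ?M) $$ (p, q)"
        using pq that set_ks by (auto simp: shifted_principal_def X_def subset_iff dest: nth_mem)
    qed (auto simp: shifted_principal_def)
    have d: "Determinant.det (?D * ?M) = Determinant.det ?D * Determinant.det ?M"
      by (rule det_mult[of _ "length ks"]) auto
    show ?thesis
      unfolding ks c d a b by (rule refl)
  qed
  then have "(\<Sum>A\<in>Pow {..<n}. (\<Prod>k\<in>A. g k) * minor M A A)
      = (\<Sum>A\<in>Pow {..<n}. Determinant.det (shifted_principal X {} (filter (\<lambda>k. k \<notin> {..<n} \<or> k \<in> A) [0..<n])))"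
    by (intro sum.cong) auto
  also have "\<dots> = Determinant.det (shifted_principal X {..<n} [0..<n])"
    by (rule sum_det_principal) auto
  also have "shifted_principal X {..<n} [0..<n] = Matrix.mat n n (\<lambda>(r, c). (if r = c then 1 else 0) + g r * M $$ (r, c))"
    by (rule eq_matI) (auto simp: shifted_principal_def X_def)
  finally show ?thesis .
qed

section \<open>The R-matrix as a triple tensor power\<close>

text \<open>The basis vector \<open>e\<close> with index \<open>d + 1\<close>, \<open>d < 8\<close>, is the set at position \<open>d\<close>, counted from 0, in the list
  \<open>{}, {0}, {1}, {2}, {0,1}, {0,2}, {1,2}, {0,1,2}\<close> of sets of colours.\<close>

definition has_colour :: "nat \<Rightarrow> nat \<Rightarrow> bool" where
  "has_colour k d \<longleftrightarrow> d \<in> [{1, 4, 5, 7}, {2, 4, 6, 7}, {3, 5, 6, 7}] ! k"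

lemma s_nonzero [simp]: "s \<noteq> 0"
  by (simp add: s_def)

lemma t_nonzero [simp]: "t \<noteq> 0"
  by (simp add: t_def)

text \<open>The entries of the \<open>2 \<times> 2\<close> Burau block at \<open>t\<^sup>-\<^sup>1\<close>: the weight for a single occupied strand to
  exchange places with its free neighbour, and the weight to stay.\<close>

abbreviation hop_weight :: K where "hop_weight \<equiv> inverse s"
definition stay_weight :: K where "stay_weight = 1 - inverse t"

lemma hop_Y: "inverse s * Y = stay_weight"
  by (simp add: stay_weight_def Y_def t_def power2_eq_square field_simps)

lemma inverse_t: "inverse t = inverse s ^ 2"
  by (simp add: t_def power_inverse)

lemma hop_power: "(inverse s ^ 2) ^ 2 = inverse s ^ 4"
  by (simp flip: power_mult)

text \<open>The scalar in front of a block of \<open>S\<close> supplies enough factors \<open>s\<^sup>-\<^sup>1\<close> to absorb every \<open>Y\<close>, so all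
  entries of \<open>S\<close> are, up to sign, monomials in the two weights.\<close>

lemma hop_Y_powers:
  "inverse s ^ 2 * Y = inverse s * stay_weight" "inverse s ^ 2 * Y ^ 2 = stay_weight ^ 2"
  "inverse s ^ 4 * Y = inverse s ^ 3 * stay_weight" "inverse s ^ 4 * Y ^ 2 = inverse s ^ 2 * stay_weight ^ 2"
  "inverse s ^ 3 * Y = inverse s ^ 2 * stay_weight" "inverse s ^ 3 * Y ^ 2 = inverse s * stay_weight ^ 2"
  "inverse s ^ 3 * Y ^ 3 = stay_weight ^ 3"
  unfolding hop_Y[symmetric] by (simp_all add: power2_eq_square power3_eq_cube power4_eq_xxxx)

abbreviation block_sum :: "K mat \<Rightarrow> (nat \<times> nat) list \<Rightarrow> nat \<Rightarrow> nat \<Rightarrow> K" where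
  "block_sum M bs r c \<equiv> (\<Sum>p < length bs. \<Sum>q < length bs.
       if r = tensor_index (bs ! p) \<and> c = tensor_index (bs ! q) then M $$ (p, q) else 0)"

lemma S_mat_block_sums:
  assumes "r < 64" "c < 64"
  shows "S_mat $$ (r, c) = (\<Sum>(M, bs) \<leftarrow> S_blocks. block_sum M bs r c)"
  using assms by (simp add: S_mat_def)

lemma sum_nth_enumerate:
  "(\<Sum>p < length xs. f p (xs ! p)) = (\<Sum>(p, x) \<leftarrow> List.enumerate 0 xs. (f p x :: K))"
  by (simp add: sum_list_sum_nth nth_enumerate_eq atLeast0LessThan)

lemma tensor_index_eq:
  assumes "b < 8" "1 \<le> i" "1 \<le> j" "j \<le> 8"
  shows "8 * a + b = tensor_index (i, j) \<longleftrightarrow> (i, j) = (Suc a, Suc b)"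
  using assms by (cases i; cases j) (simp_all add: tensor_index_def, presburger)

lemma mat_block_dims: "dim_row matA = 2" "dim_col matA = 2"
  "dim_row matB = 4" "dim_col matB = 4" "dim_row matC = 8" "dim_col matC = 8"
  by (simp_all add: matA_def matB_def matC_def mat_of_rows_list_def)

lemma matA_entries:
  "p < 2 \<Longrightarrow> q < 2 \<Longrightarrow> matA $$ (p, q) = [[0, inverse s], [inverse s, stay_weight]] ! p ! q"
  by (simp add: matA_def stay_weight_def mat_of_rows_list_def)

lemma matB_entries:
  "p < 4 \<Longrightarrow> q < 4 \<Longrightarrow> matB $$ (p, q) = [[0, 0, 0, 1], [0, 0, 1, Y], [0, 1, 0, Y], [1, Y, Y, Y^2]] ! p ! q"
  by (simp add: matB_def mat_of_rows_list_def)

lemma matC_entries: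
  "p < 8 \<Longrightarrow> q < 8 \<Longrightarrow> matC $$ (p, q) = 
     [[0, 0, 0, 0, 0, 0, 0, 1],
      [0, 0, 0, 0, 0, 0, 1, Y],
      [0, 0, 0, 0, 0, 1, 0, Y],
      [0, 0, 0, 0, 1, 0, 0, Y],
      [0, 0, 0, 1, 0, Y, Y, Y^2],
      [0, 0, 1, 0, Y, 0, Y, Y^2],
      [0, 1, 0, 0, Y, Y, 0, Y^2],
      [1, Y, Y, Y, Y^2, Y^2, Y^2, Y^3]] ! p ! q"
  by (simp add: matC_def mat_of_rows_list_def)

lemma matD_entries:
  "p < 8 \<Longrightarrow> q < 8 \<Longrightarrow> matD $$ (p, q) = (if p = q then [1, - inverse t, - inverse t, - inverse t,
     inverse t ^ 2, inverse t ^ 2, inverse t ^ 2, - (inverse t ^ 3)] ! p else 0)"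
  by (simp add: matD_def diag_mat_of_def)

lemma less_8: "n < 8 \<Longrightarrow> n \<in> {0, 1, 2, 3, 4, 5, 6, 7 :: nat}"
  by auto
lemma has_colour_table:
  "\<not> has_colour 0 0" "\<not> has_colour 1 0" "\<not> has_colour 2 0"
  "has_colour 0 1" "\<not> has_colour 1 1" "\<not> has_colour 2 1"
  "\<not> has_colour 0 2" "has_colour 1 2" "\<not> has_colour 2 2"
  "\<not> has_colour 0 3" "\<not> has_colour 1 3" "has_colour 2 3"
  "has_colour 0 4" "has_colour 1 4" "\<not> has_colour 2 4"
  "has_colour 0 5" "\<not> has_colour 1 5" "has_colour 2 5"
  "\<not> has_colour 0 6" "has_colour 1 6" "has_colour 2 6"
  "has_colour 0 7" "has_colour 1 7" "has_colour 2 7"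
  by (simp_all add: has_colour_def)

lemma local_weight_table:
  "local_weight w z (False, False) (False, False) = 1"
  "local_weight w z (False, False) (False, True) = 0"
  "local_weight w z (False, False) (True, False) = 0"
  "local_weight w z (False, False) (True, True) = 0"
  "local_weight w z (False, True) (False, False) = 0"
  "local_weight w z (False, True) (False, True) = 0"
  "local_weight w z (False, True) (True, False) = w"
  "local_weight w z (False, True) (True, True) = 0"
  "local_weight w z (True, False) (False, False) = 0"
  "local_weight w z (True, False) (False, True) = w"
  "local_weight w z (True, False) (True, False) = z"
  "local_weight w z (True, False) (True, True) = 0"
  "local_weight w z (True, True) (False, False) = 0"
  "local_weight w z (True, True) (False, True) = 0"
  "local_weight w z (True, True) (True, False) = 0"
  "local_weight w z (True, True) (True, True) = - (w ^ 2)"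
  by (simp_all add: local_weight_def)

lemma prod_three_colours: "(\<Prod>k<3. f k) = f 0 * f 1 * (f (2 :: nat) :: K)"
  by (simp add: eval_nat_numeral mult.assoc)

lemma pairs_in_range:
  "(M, bs) \<in> set S_blocks \<Longrightarrow> x \<in> set bs \<Longrightarrow> 1 \<le> fst x \<and> 1 \<le> snd x \<and> snd x \<le> 8"
  unfolding S_blocks_def by auto

lemma S_mat_pairs:
  assumes "a1 < 8" "a2 < 8" "b1 < 8" "b2 < 8"
  shows "S_mat $$ (8 * a1 + a2, 8 * b1 + b2) = (\<Sum>(M, bs) \<leftarrow> S_blocks. \<Sum>(p, x) \<leftarrow> List.enumerate 0 bs.
    if x = (Suc a1, Suc a2)
    then (\<Sum>(q, y) \<leftarrow> List.enumerate 0 bs. if y = (Suc b1, Suc b2) then M $$ (p, q) else 0) else 0)"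
proof -
  have "block_sum M bs (8 * a1 + a2) (8 * b1 + b2) = (\<Sum>(p, x) \<leftarrow> List.enumerate 0 bs.
      if x = (Suc a1, Suc a2)
      then (\<Sum>(q, y) \<leftarrow> List.enumerate 0 bs. if y = (Suc b1, Suc b2) then M $$ (p, q) else 0) else 0)"
    if "(M, bs) \<in> set S_blocks" for M bs
  proof -
    have eq: "8 * a + b = tensor_index (bs ! p) \<longleftrightarrow> bs ! p = (Suc a, Suc b)" if "b < 8" "p < length bs" for a b p
      using pairs_in_range[OF \<open>(M, bs) \<in> set S_blocks\<close> nth_mem[OF that(2)]] that(1)
        tensor_index_eq[of b "fst (bs ! p)" "snd (bs ! p)" a] by simp
    have "block_sum M bs (8 * a1 + a2) (8 * b1 + b2) = (\<Sum>p < length bs. if bs ! p = (Suc a1, Suc a2)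
       then \<Sum>q < length bs. if bs ! q = (Suc b1, Suc b2) then M $$ (p, q) else 0 else 0)"
      using assms by (intro sum.cong) (auto simp: eq intro!: sum.cong)
    then show ?thesis
      by (simp only: sum_nth_enumerate[of "\<lambda>q y. if y = (Suc b1, Suc b2) then M $$ (p, q) else 0" for p]
        sum_nth_enumerate[of "\<lambda>p x. if x = (Suc a1, Suc a2) then g p else 0" for g])
  qed
  then have "(\<Sum>(M, bs) \<leftarrow> S_blocks. block_sum M bs (8 * a1 + a2) (8 * b1 + b2))
      = (\<Sum>(M, bs) \<leftarrow> S_blocks. \<Sum>(p, x) \<leftarrow> List.enumerate 0 bs.
    if x = (Suc a1, Suc a2)
    then (\<Sum>(q, y) \<leftarrow> List.enumerate 0 bs. if y = (Suc b1, Suc b2) then M $$ (p, q) else 0) else 0)"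
    by (intro arg_cong[where f = sum_list] map_cong refl) auto
  then show ?thesis
    using assms S_mat_block_sums[of "8 * a1 + a2" "8 * b1 + b2"] by simp
qed

lemma all_digitsI:
  assumes "P 0" "P 1" "P 2" "P 3" "P 4" "P 5" "P 6" "P (7 :: nat)"
  shows "\<forall>d<8. P d"
proof (intro allI impI)
  fix d :: nat assume "d < 8"
  then show "P d" using less_8[of d] assms by blast
qed

text \<open>A finite check of \<open>8\<^sup>4\<close> entries, of which all but \<open>5\<^sup>3\<close> vanish on both sides.\<close>

lemma S_entries:
  "\<forall>a1<8. \<forall>a2<8. \<forall>b1<8. \<forall>b2<8. (\<Sum>(M, bs) \<leftarrow> S_blocks. \<Sum>(p, x) \<leftarrow> List.enumerate 0 bs.
    if x = (Suc a1, Suc a2)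
    then (\<Sum>(q, y) \<leftarrow> List.enumerate 0 bs. if y = (Suc b1, Suc b2) then M $$ (p, q) else 0) else 0)
   = (\<Prod>k<3. local_weight hop_weight stay_weight
        (has_colour k a1, has_colour k a2) (has_colour k b1, has_colour k b2))"
  unfolding prod_three_colours
  (* The blocks are flattened once, with symbolic indices; splitting the conditions is postponed
     until the indices are numerals, since otherwise the number of cases explodes. The simplifier
     writes the numeral 1 as Suc 0, hence the unfolding in the table of colours. *)
  apply (simp split del: if_split add: S_blocks_def mat_block_dims
    matA_entries matB_entries matC_entries matD_entries inverse_t hop_Y hop_Y_powers hop_power cong: if_cong)
  apply (rule all_digitsI; rule all_digitsI;
      simp split del: if_split add: has_colour_table[unfolded One_nat_def] cong: if_cong;
      rule all_digitsI; rule all_digitsI;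
      simp add: has_colour_table[unfolded One_nat_def] local_weight_table;
      simp add: power2_eq_square power3_eq_cube power4_eq_xxxx)
  done

text \<open>In terms of sets of colours, \<open>S\<close> is the triple tensor power of a \<open>4 \<times> 4\<close> matrix, without any
  signs: the basis of \<open>W\<close> is adapted to ordering the tensor factors by colour first.\<close>

lemma S_entry:
  assumes "a1 < 8" "a2 < 8" "b1 < 8" "b2 < 8"
  shows "S_mat $$ (8 * a1 + a2, 8 * b1 + b2) = (\<Prod>k<3. local_weight hop_weight stay_weight
    (has_colour k a1, has_colour k a2) (has_colour k b1, has_colour k b2))"
  unfolding S_mat_pairs[OF assms] using S_entries assms by blast

section \<open>Basis vectors as triples of sets of strands\<close>

text \<open>The strands \<open>p < n\<close> that carry colour \<open>k\<close> in the basis vector of \<open>W\<^sup>\<otimes>\<^sup>n\<close> with index \<open>r\<close>. The first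
  strand is the leading base-8 digit, in accordance with the Kronecker product.\<close>

definition colour_set :: "nat \<Rightarrow> nat \<Rightarrow> nat \<Rightarrow> nat set" where
  "colour_set n k r = {p. p < n \<and> has_colour k (r div 8 ^ (n - Suc p) mod 8)}"

lemma colour_set_subset: "colour_set n k r \<subseteq> {..<n}"
  by (auto simp: colour_set_def)

lemma digits_determine:
  fixes x y :: nat
  assumes "x < 8 ^ m" "y < 8 ^ m" "\<And>j. j < m \<Longrightarrow> x div 8 ^ j mod 8 = y div 8 ^ j mod 8"
  shows "x = y"
  using assms
proof (induction m arbitrary: x y)
  case 0
  then show ?case by simp
next
  case (Suc m)
  have "x div 8 = y div 8"
  proof (rule Suc.IH)
    show "x div 8 < 8 ^ m" "y div 8 < 8 ^ m"
      using Suc.prems(1,2) by (simp_all add: less_mult_imp_div_less mult.commute)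
    show "x div 8 div 8 ^ j mod 8 = y div 8 div 8 ^ j mod 8" if "j < m" for j
      using Suc.prems(3)[of "Suc j"] that by (simp add: div_mult2_eq)
  qed
  moreover have "x mod 8 = y mod 8"
    using Suc.prems(3)[of 0] by simp
  ultimately show ?case
    by (metis div_mult_mod_eq)
qed

lemma colours_determine_digit:
  assumes "d < 8" "e < 8" "\<And>k. k < 3 \<Longrightarrow> has_colour k d = has_colour k e"
  shows "d = e"
proof -
  have "\<forall>d<8. \<forall>e<8. (has_colour 0 d = has_colour 0 e) \<longrightarrow> (has_colour 1 d = has_colour 1 e) \<longrightarrow>
      (has_colour 2 d = has_colour 2 e) \<longrightarrow> d = e"
    by (rule all_digitsI; rule all_digitsI; simp add: has_colour_table[unfolded One_nat_def])
  then show ?thesis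
    using assms(1,2) assms(3)[of 0] assms(3)[of 1] assms(3)[of 2] by simp
qed

lemma same_colour_sets_outside:
  "(\<forall>k<3. colour_set n k r - X = colour_set n k c - X) \<longleftrightarrow>
   (\<forall>p<n. p \<notin> X \<longrightarrow> r div 8 ^ (n - Suc p) mod 8 = c div 8 ^ (n - Suc p) mod 8)"
proof
  assume eq: "\<forall>k<3. colour_set n k r - X = colour_set n k c - X"
  show "\<forall>p<n. p \<notin> X \<longrightarrow> r div 8 ^ (n - Suc p) mod 8 = c div 8 ^ (n - Suc p) mod 8"
  proof (intro allI impI)
    fix p assume p: "p < n" "p \<notin> X"
    show "r div 8 ^ (n - Suc p) mod 8 = c div 8 ^ (n - Suc p) mod 8"
    proof (rule colours_determine_digit)
      fix k :: nat assume "k < 3"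
      then have "p \<in> colour_set n k r - X \<longleftrightarrow> p \<in> colour_set n k c - X"
        using eq by blast
      then show "has_colour k (r div 8 ^ (n - Suc p) mod 8) = has_colour k (c div 8 ^ (n - Suc p) mod 8)"
        using p by (simp add: colour_set_def)
    qed simp_all
  qed
next
  assume eq: "\<forall>p<n. p \<notin> X \<longrightarrow> r div 8 ^ (n - Suc p) mod 8 = c div 8 ^ (n - Suc p) mod 8"
  show "\<forall>k<3. colour_set n k r - X = colour_set n k c - X"
  proof (intro allI impI Set.set_eqI)
    fix k p
    show "p \<in> colour_set n k r - X \<longleftrightarrow> p \<in> colour_set n k c - X"
      using eq by (cases "p < n"; cases "p \<in> X") (simp_all add: colour_set_def)
  qed
qed

lemma colour_sets_determine:
  assumes "r < 8 ^ n" "c < 8 ^ n" "\<And>k. k < 3 \<Longrightarrow> colour_set n k r = colour_set n k c"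
  shows "r = c"
proof (rule digits_determine[OF assms(1,2)])
  fix j assume j: "j < n"
  have "\<forall>p<n. p \<notin> {} \<longrightarrow> r div 8 ^ (n - Suc p) mod 8 = c div 8 ^ (n - Suc p) mod 8"
    by (subst same_colour_sets_outside[symmetric]) (simp add: assms(3))
  from this[rule_format, of "n - Suc j"]
  have "r div 8 ^ (n - Suc (n - Suc j)) mod 8 = c div 8 ^ (n - Suc (n - Suc j)) mod 8"
    using j by simp
  then show "r div 8 ^ j mod 8 = c div 8 ^ j mod 8"
    using j by (simp add: Suc_diff_Suc)
qed

lemma bij_betw_colour_sets:
  "bij_betw (\<lambda>r. (colour_set n 0 r, colour_set n 1 r, colour_set n 2 r)) {..<8 ^ n}
     (Pow {..<n} \<times> Pow {..<n} \<times> Pow {..<n})"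
  (is "bij_betw ?f ?R ?P")
proof -
  have inj: "inj_on ?f ?R"
  proof (rule inj_onI)
    fix r c assume rc: "r \<in> ?R" "c \<in> ?R" "?f r = ?f c"
    show "r = c"
    proof (rule colour_sets_determine)
      fix k :: nat assume "k < 3"
      then have "k = 0 \<or> k = 1 \<or> k = 2" by auto
      then show "colour_set n k r = colour_set n k c" using rc(3) by auto
    qed (use rc in auto)
  qed
  moreover have "?f ` ?R = ?P"
  proof (rule card_subset_eq)
    show "?f ` ?R \<subseteq> ?P" using colour_set_subset by fast
    have "(2::nat) ^ n * (2 ^ n * 2 ^ n) = 8 ^ n"
      by (simp flip: power_mult_distrib)
    then have "card ?P = 8 ^ n"
      by (simp add: card_cartesian_product card_Pow)
    then show "card (?f ` ?R) = card ?P"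
      by (simp only: card_image[OF inj] card_lessThan)
  qed simp
  ultimately show ?thesis by (simp add: bij_betw_def)
qed

text \<open>A basis vector of \<open>W\<^sup>\<otimes>\<^sup>n\<close> is the same as three independent sets of strands, so sums of products
  over the colours factorise.\<close>

lemma sum_over_colour_sets:
  "(\<Sum>r<8 ^ n. \<Prod>k<3. F k (colour_set n k r)) = (\<Prod>k<3. \<Sum>A\<in>Pow {..<n}. (F k A :: K))"
proof -
  have "(\<Sum>r<8 ^ n. \<Prod>k<3. F k (colour_set n k r))
      = (\<Sum>(A, B, C)\<in>Pow {..<n} \<times> Pow {..<n} \<times> Pow {..<n}. F 0 A * F 1 B * F 2 C)"
    using sum.reindex_bij_betw[OF bij_betw_colour_sets[of n], of "\<lambda>(A, B, C). F 0 A * F 1 B * F 2 C"]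
    by (simp add: prod_three_colours)
  also have "\<dots> = (\<Prod>k<3. \<Sum>A\<in>Pow {..<n}. F k A)"
    by (simp add: prod_three_colours sum.cartesian_product[symmetric] sum_distrib_left[symmetric]
        sum_distrib_right[symmetric] mult.assoc)
  finally show ?thesis .
qed

lemma digit_of_mod:
  fixes x :: nat
  assumes "j < e"
  shows "x mod 8 ^ e div 8 ^ j mod 8 = x div 8 ^ j mod 8"
proof -
  have e: "(8::nat) ^ e = 8 ^ j * 8 ^ (e - j)"
    using assms by (simp flip: power_add)
  have "x mod 8 ^ e div 8 ^ j = x div 8 ^ j mod 8 ^ (e - j)"
    unfolding e by (simp add: mod_mult2_eq)
  moreover have "(8::nat) dvd 8 ^ (e - j)"
    using assms by (simp add: dvd_power)
  ultimately show ?thesis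
    by (simp add: mod_mod_cancel)
qed

lemma same_outside_two_strands:
  fixes r c :: nat
  assumes n: "n = i + 2 + e" and rc: "r < 8 ^ n" "c < 8 ^ n"
  shows "(\<forall>k<3. colour_set n k r - {i, Suc i} = colour_set n k c - {i, Suc i}) \<longleftrightarrow>
    r div 8 ^ e div 64 = c div 8 ^ e div 64 \<and> r mod 8 ^ e = c mod 8 ^ e"
    (is "?S \<longleftrightarrow> ?H \<and> ?L")
proof -
  have "(8::nat) ^ (e + 2) = 8 ^ e * 64"
    by (simp add: power_add)
  then have div: "x div 8 ^ e div 64 = x div 8 ^ (e + 2)" for x :: nat
    by (simp only: div_mult2_eq)
  have hi: "x div 8 ^ e div 64 div 8 ^ j mod 8 = x div 8 ^ (n - Suc (i - Suc j)) mod 8" if "j < i" for x j :: nat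
  proof -
    have "n - Suc (i - Suc j) = (e + 2) + j" using that n by simp
    then show ?thesis unfolding div by (simp only: power_add[of _ "e + 2" j] div_mult2_eq)
  qed
  have "n = i + (e + 2)" using n by simp
  then have pow: "(8::nat) ^ n = 8 ^ i * 8 ^ (e + 2)"
    by (simp only: power_add)
  have bound: "x div 8 ^ e div 64 < 8 ^ i" if "x < 8 ^ n" for x :: nat
    using that unfolding div pow by (rule less_mult_imp_div_less)
  show ?thesis
    unfolding same_colour_sets_outside
  proof
    assume *: "\<forall>p<n. p \<notin> {i, Suc i} \<longrightarrow> r div 8 ^ (n - Suc p) mod 8 = c div 8 ^ (n - Suc p) mod 8"
    have ?H
    proof (rule digits_determine[OF bound[OF rc(1)] bound[OF rc(2)]])
      fix j assume j: "j < i"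
      have "i - Suc j < n" "i - Suc j \<notin> {i, Suc i}" using j n by auto
      then show "r div 8 ^ e div 64 div 8 ^ j mod 8 = c div 8 ^ e div 64 div 8 ^ j mod 8"
        unfolding hi[OF j] using * by blast
    qed
    moreover have ?L
    proof (rule digits_determine[of _ e])
      fix j assume j: "j < e"
      have "n - Suc j < n" "n - Suc j \<notin> {i, Suc i}" using j n by auto
      then have "r div 8 ^ (n - Suc (n - Suc j)) mod 8 = c div 8 ^ (n - Suc (n - Suc j)) mod 8"
        using * by blast
      moreover have "n - Suc (n - Suc j) = j" using j n by simp
      ultimately show "r mod 8 ^ e div 8 ^ j mod 8 = c mod 8 ^ e div 8 ^ j mod 8"
        unfolding digit_of_mod[OF j] by (simp only:)
    qed simp_all
    ultimately show "?H \<and> ?L" ..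
  next
    assume HL: "?H \<and> ?L"
    show "\<forall>p<n. p \<notin> {i, Suc i} \<longrightarrow> r div 8 ^ (n - Suc p) mod 8 = c div 8 ^ (n - Suc p) mod 8"
    proof (intro allI impI)
      fix p assume p: "p < n" "p \<notin> {i, Suc i}"
      show "r div 8 ^ (n - Suc p) mod 8 = c div 8 ^ (n - Suc p) mod 8"
      proof (cases "p < i")
        case True
        then have p': "i - Suc (i - Suc p) = p" "i - Suc p < i" by auto
        show ?thesis
          using hi[OF p'(2), of r] hi[OF p'(2), of c] HL unfolding p'(1) by (simp only:)
      next
        case False
        then have p': "n - Suc p < e" using p n by auto
        show ?thesis
          using HL digit_of_mod[OF p', of r] digit_of_mod[OF p', of c] by (simp only:)
      qed
    qed
  qed
qed

lemma kron_index:
  assumes "r < dim_row M * dim_row N" "c < dim_col M * dim_col N"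
  shows "kron M N $$ (r, c) = M $$ (r div dim_row N, c div dim_col N) * N $$ (r mod dim_row N, c mod dim_col N)"
  using assms by (simp add: kron_def)

lemma kron_dim [simp]: "dim_row (kron M N) = dim_row M * dim_row N" "dim_col (kron M N) = dim_col M * dim_col N"
  by (simp_all add: kron_def)

lemma S_mat_dim [simp]: "dim_row S_mat = 64" "dim_col S_mat = 64"
  by (simp_all add: S_mat_def)

lemma S_rep_gen_dim:
  assumes "1 \<le> i" "i < n"
  shows "S_rep_gen n i \<in> carrier_mat (8 ^ n) (8 ^ n)"
proof -
  have "n = (i - 1) + 2 + (n - i - 1)" using assms by simp
  then have "(8::nat) ^ n = 8 ^ (i - 1) * 8 ^ 2 * 8 ^ (n - i - 1)"
    by (simp only: power_add[symmetric])
  then show ?thesis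
    by (intro carrier_matI) (simp_all add: S_rep_gen_def)
qed

text \<open>A generator of the braid group acts on each colour separately, by the exterior algebra of a local
  matrix: the identity factors of the tensor product force the other strands to agree.\<close>

lemma S_rep_gen_index:
  assumes i: "1 \<le> i" "i < n" and rc: "r < 8 ^ n" "c < 8 ^ n"
  shows "S_rep_gen n i $$ (r, c) =
    (\<Prod>k<3. exterior_local hop_weight stay_weight (i - 1) (colour_set n k r) (colour_set n k c))"
proof -
  define e where "e = n - i - 1"
  define l where "l = i - 1"
  have n: "n = l + 2 + e" and i': "i = Suc l"
    using i by (simp_all add: e_def l_def)
  have pow: "(8::nat) ^ n = 8 ^ l * 64 * 8 ^ e"
    unfolding n by (simp add: power_add)
  have q: "x div 8 ^ e < 8 ^ l * 64" "x div 8 ^ e div 64 < 8 ^ l" if "x < 8 ^ n" for x :: nat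
  proof -
    show "x div 8 ^ e < 8 ^ l * 64"
      using that unfolding pow by (rule less_mult_imp_div_less)
    then show "x div 8 ^ e div 64 < 8 ^ l"
      by (rule less_mult_imp_div_less)
  qed
  have two: "x mod 64 = 8 * (x div 8 mod 8) + x mod 8" for x :: nat
    using mod_mult2_eq[of x 8 8] by simp
  have dig: "(l \<in> colour_set n k x) = has_colour k (x div 8 ^ e div 8 mod 8)"
    "(Suc l \<in> colour_set n k x) = has_colour k (x div 8 ^ e mod 8)" for k x
  proof -
    have "n - Suc l = Suc e" "n - Suc (Suc l) = e" "l < n" "Suc l < n" by (simp_all add: n)
    then show "(l \<in> colour_set n k x) = has_colour k (x div 8 ^ e div 8 mod 8)"
      "(Suc l \<in> colour_set n k x) = has_colour k (x div 8 ^ e mod 8)"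
      unfolding colour_set_def by (simp_all add: div_mult2_eq[symmetric] mult.commute)
  qed
  have "S_rep_gen n i $$ (r, c) = (if r div 8 ^ e div 64 = c div 8 ^ e div 64 then 1 else 0)
      * S_mat $$ (r div 8 ^ e mod 64, c div 8 ^ e mod 64) * (if r mod 8 ^ e = c mod 8 ^ e then 1 else 0)"
    unfolding S_rep_gen_def l_def[symmetric] e_def[symmetric]
    using rc q[OF rc(1)] q[OF rc(2)] by (simp add: kron_index pow)
  moreover have "S_mat $$ (r div 8 ^ e mod 64, c div 8 ^ e mod 64) = (\<Prod>k<3. local_weight hop_weight stay_weight
      (l \<in> colour_set n k r, Suc l \<in> colour_set n k r) (l \<in> colour_set n k c, Suc l \<in> colour_set n k c))"
    unfolding two dig by (rule S_entry) simp_all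
  ultimately have S: "S_rep_gen n i $$ (r, c) = (if r div 8 ^ e div 64 = c div 8 ^ e div 64 then 1 else 0)
      * (\<Prod>k<3. local_weight hop_weight stay_weight
      (l \<in> colour_set n k r, Suc l \<in> colour_set n k r) (l \<in> colour_set n k c, Suc l \<in> colour_set n k c))
      * (if r mod 8 ^ e = c mod 8 ^ e then 1 else 0)"
    by (simp only:)
  show ?thesis
  proof (cases "\<forall>k<3. colour_set n k r - {l, Suc l} = colour_set n k c - {l, Suc l}")
    case True
    then have "r div 8 ^ e div 64 = c div 8 ^ e div 64" "r mod 8 ^ e = c mod 8 ^ e"
      using same_outside_two_strands[OF n rc] by blast+
    then show ?thesis
      unfolding S l_def[symmetric] using True by (auto simp: exterior_local_def intro!: prod.cong)
  next
    case False
    then obtain k where "k < 3" "colour_set n k r - {l, Suc l} \<noteq> colour_set n k c - {l, Suc l}"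
      by blast
    then have "(\<Prod>k<3. exterior_local hop_weight stay_weight l (colour_set n k r) (colour_set n k c)) = 0"
      by (intro prod_zero) (auto simp: exterior_local_def)
    moreover have "\<not> (r div 8 ^ e div 64 = c div 8 ^ e div 64 \<and> r mod 8 ^ e = c mod 8 ^ e)"
      using False same_outside_two_strands[OF n rc] by blast
    ultimately show ?thesis
      unfolding S l_def[symmetric] by auto
  qed
qed

section \<open>The action of braids on three exterior algebras\<close>

text \<open>The triple tensor power of the exterior algebra of \<open>M\<close>, in the basis of \<open>W\<^sup>\<otimes>\<^sup>n\<close>
  and with its tensor factors in the order of that basis.\<close>

definition three_exterior :: "nat \<Rightarrow> K mat \<Rightarrow> K mat" where
  "three_exterior n M = Matrix.mat (8 ^ n) (8 ^ n)
     (\<lambda>(r, c). \<Prod>k<3. minor M (colour_set n k r) (colour_set n k c))"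

lemma three_exterior_carrier [simp]: "three_exterior n M \<in> carrier_mat (8 ^ n) (8 ^ n)"
  by (simp add: three_exterior_def)

lemma three_exterior_one: "three_exterior n (1\<^sub>m n) = 1\<^sub>m (8 ^ n)"
proof (rule eq_matI)
  fix r c assume "r < dim_row (1\<^sub>m (8 ^ n) :: K mat)" "c < dim_col (1\<^sub>m (8 ^ n) :: K mat)"
  then have rc: "r < 8 ^ n" "c < 8 ^ n" by simp_all
  have "(\<Prod>k<3. if colour_set n k r = colour_set n k c then 1 else 0) = (if r = c then 1 else 0 :: K)"
  proof (cases "r = c")
    case False
    then obtain k where "k < 3" "colour_set n k r \<noteq> colour_set n k c"
      using colour_sets_determine[OF rc] by blast
    then show ?thesis
      using False by (auto intro!: prod_zero)
  qed simp
  then show "three_exterior n (1\<^sub>m n) $$ (r, c) = 1\<^sub>m (8 ^ n) $$ (r, c)"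
    using rc by (simp add: three_exterior_def minor_one colour_set_subset)
qed (simp_all add: three_exterior_def)

lemma S_rep_gen_mult_three_exterior:
  assumes i: "1 \<le> i" "i < n" and M: "M \<in> carrier_mat n n"
  shows "S_rep_gen n i * three_exterior n M = three_exterior n (local_mat hop_weight stay_weight n (i - 1) * M)"
proof (rule eq_matI)
  let ?P = "local_mat hop_weight stay_weight n (i - 1)"
  note S = S_rep_gen_dim[OF i]
  show "dim_row (S_rep_gen n i * three_exterior n M) = dim_row (three_exterior n (?P * M))"
    "dim_col (S_rep_gen n i * three_exterior n M) = dim_col (three_exterior n (?P * M))"
    using S by (simp_all add: three_exterior_def)
  fix r c assume "r < dim_row (three_exterior n (?P * M))" "c < dim_col (three_exterior n (?P * M))"
  then have rc: "r < 8 ^ n" "c < 8 ^ n" by (simp_all add: three_exterior_def)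
  have "(S_rep_gen n i * three_exterior n M) $$ (r, c)
      = (\<Sum>l<8 ^ n. S_rep_gen n i $$ (r, l) * three_exterior n M $$ (l, c))"
    by (rule mult_mat_index[OF S three_exterior_carrier rc])
  also have "\<dots> = (\<Sum>l<8 ^ n. \<Prod>k<3. exterior_local hop_weight stay_weight (i - 1) (colour_set n k r) (colour_set n k l)
      * minor M (colour_set n k l) (colour_set n k c))"
    using rc by (intro sum.cong) (simp_all add: S_rep_gen_index[OF i] three_exterior_def prod.distrib)
  also have "\<dots> = (\<Prod>k<3. \<Sum>C\<in>Pow {..<n}. exterior_local hop_weight stay_weight (i - 1) (colour_set n k r) C
      * minor M C (colour_set n k c))"
    by (rule sum_over_colour_sets)
  also have "\<dots> = (\<Prod>k<3. minor (?P * M) (colour_set n k r) (colour_set n k c))"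
    using i by (intro prod.cong refl sum_exterior_local_minor[OF M] colour_set_subset) simp
  finally show "(S_rep_gen n i * three_exterior n M) $$ (r, c) = three_exterior n (?P * M) $$ (r, c)"
    using rc by (simp add: three_exterior_def)
qed

lemma the_mat_inverse:
  assumes A: "A \<in> carrier_mat d d" and B: "B \<in> carrier_mat d d" and AB: "A * B = 1\<^sub>m d"
  shows "the (mat_inverse A) = (B :: K mat)"
proof (cases "mat_inverse A")
  case None
  have "Determinant.det A * Determinant.det B = 1"
    using det_mult[OF A B] by (simp add: AB)
  then have "Determinant.det A \<noteq> 0"
    by auto
  then have "A \<in> Units (ring_mat TYPE(K) d ())"
    by (rule det_non_zero_imp_unit[OF A])
  then show ?thesis
    using mat_inverse(1)[OF A None, where b = "()"] by contradiction
next
  case (Some C)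
  then have C: "C * A = 1\<^sub>m d" "C \<in> carrier_mat d d"
    using mat_inverse(2)[OF A] by auto
  have "C = C * (A * B)"
    using C AB by simp
  also have "\<dots> = (C * A) * B"
    by (rule assoc_mult_mat[OF C(2) A B, symmetric])
  also have "\<dots> = B"
    using B C by simp
  finally show ?thesis using Some by simp
qed

lemma braid_rep_Nil [simp]: "braid_rep d \<rho> [] = 1\<^sub>m d"
  by (simp add: braid_rep_def)

lemma braid_rep_Cons [simp]:
  "braid_rep d \<rho> ((i, e) # b) = (if e then \<rho> i else the (mat_inverse (\<rho> i))) * braid_rep d \<rho> b"
  by (simp add: braid_rep_def)

lemma is_braid_Cons: "is_braid n ((i, e) # b) \<longleftrightarrow> 1 \<le> i \<and> i < n \<and> is_braid n b"
  by (auto simp: is_braid_def)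

text \<open>The Burau matrices at the parameter \<open>t\<^sup>-\<^sup>1\<close>.\<close>

definition dual_burau_gen :: "nat \<Rightarrow> nat \<Rightarrow> K mat" where
  "dual_burau_gen n i = local_mat hop_weight stay_weight n (i - 1)"

lemma weight_relation: "stay_weight * s + inverse s * (1 - t) = 0" "(1 - t) * inverse s + s * stay_weight = 0"
  by (simp_all add: stay_weight_def t_def field_simps power2_eq_square)

lemma dual_burau_gen_inverse:
  assumes "1 \<le> i" "i < n"
  shows "dual_burau_gen n i * two_strand_mat 0 s s (1 - t) n (i - 1) = 1\<^sub>m n"
  unfolding dual_burau_gen_def using assms
  by (subst two_strand_mat_mult) (simp_all add: weight_relation two_strand_mat_one)

text \<open>Invertibility of the generators of \<open>S_rep\<close> comes from that of the \<open>n \<times> n\<close> matrices.\<close>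

lemma S_rep_gen_inverse:
  assumes i: "1 \<le> i" "i < n"
  shows "S_rep_gen n i * three_exterior n (two_strand_mat 0 s s (1 - t) n (i - 1)) = 1\<^sub>m (8 ^ n)"
  by (simp only: S_rep_gen_mult_three_exterior[OF i two_strand_mat_carrier] dual_burau_gen_def[symmetric]
      dual_burau_gen_inverse[OF i] three_exterior_one)

lemma inverse_S_rep_gen_mult_three_exterior:
  assumes i: "1 \<le> i" "i < n" and M: "M \<in> carrier_mat n n"
  shows "the (mat_inverse (S_rep_gen n i)) * three_exterior n M
    = three_exterior n (the (mat_inverse (dual_burau_gen n i)) * M)"
proof -
  let ?S = "S_rep_gen n i" and ?V = "two_strand_mat 0 s s (1 - t) n (i - 1)"
  let ?T = "three_exterior n ?V"
  note S = S_rep_gen_dim[OF i]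
  have P: "dual_burau_gen n i \<in> carrier_mat n n" by (simp add: dual_burau_gen_def)
  have VM: "?V * M \<in> carrier_mat n n"
    using M by (intro mult_carrier_mat[of _ n n]) simp_all
  have "?S * three_exterior n (?V * M) = three_exterior n (dual_burau_gen n i * (?V * M))"
    using S_rep_gen_mult_three_exterior[OF i VM] by (simp add: dual_burau_gen_def)
  also have "dual_burau_gen n i * (?V * M) = (dual_burau_gen n i * ?V) * M"
    using P M by (intro assoc_mult_mat[symmetric, of _ n n _ n _ n]) simp_all
  also have "\<dots> = M"
    unfolding dual_burau_gen_inverse[OF i] using M by (rule left_mult_one_mat)
  finally have "?T * three_exterior n M = ?T * (?S * three_exterior n (?V * M))"
    by simp
  also have "\<dots> = (?T * ?S) * three_exterior n (?V * M)"
    using S by (intro assoc_mult_mat[symmetric, of _ "8 ^ n" "8 ^ n" _ "8 ^ n" _ "8 ^ n"]) simp_all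
  also have "?T * ?S = 1\<^sub>m (8 ^ n)"
    using mat_mult_left_right_inverse[OF S three_exterior_carrier S_rep_gen_inverse[OF i]] .
  also have "1\<^sub>m (8 ^ n) * three_exterior n (?V * M) = three_exterior n (?V * M)"
    by (rule left_mult_one_mat[OF three_exterior_carrier])
  finally show ?thesis
    using the_mat_inverse[OF S three_exterior_carrier S_rep_gen_inverse[OF i]]
      the_mat_inverse[OF P two_strand_mat_carrier dual_burau_gen_inverse[OF i]] by simp
qed

definition dual_burau :: "nat \<Rightarrow> braid_word \<Rightarrow> K mat" where
  "dual_burau n b = braid_rep n (dual_burau_gen n) b"

lemma S_rep_eq_three_exterior:
  assumes "is_braid n b"
  shows "dual_burau n b \<in> carrier_mat n n \<and> S_rep n b = three_exterior n (dual_burau n b)"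
  using assms
proof (induction b)
  case Nil
  then show ?case
    by (simp add: dual_burau_def S_rep_def three_exterior_one)
next
  case (Cons l b)
  obtain i e where l: "l = (i, e)" by (cases l)
  have i: "1 \<le> i" "i < n" and b: "is_braid n b"
    using Cons.prems unfolding l is_braid_Cons by auto
  note IH = Cons.IH[OF b]
  have P: "dual_burau_gen n i \<in> carrier_mat n n" by (simp add: dual_burau_gen_def)
  have "the (mat_inverse (dual_burau_gen n i)) \<in> carrier_mat n n"
    using the_mat_inverse[OF P two_strand_mat_carrier dual_burau_gen_inverse[OF i]] by simp
  moreover have "S_rep n (l # b) = three_exterior n (dual_burau n (l # b))"
    using IH S_rep_gen_mult_three_exterior[OF i, of "dual_burau n b"]
      inverse_S_rep_gen_mult_three_exterior[OF i, of "dual_burau n b"]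
    by (cases e) (simp_all add: l S_rep_def dual_burau_def dual_burau_gen_def)
  ultimately show ?case
    using IH P by (cases e) (simp_all add: l dual_burau_def mult_carrier_mat[of _ n n])
qed

section \<open>The weighted trace\<close>

lemma colour_set_Suc:
  assumes "r < 8 ^ Suc m"
  shows "colour_set (Suc m) k r = (if has_colour k (r div 8 ^ m) then {0} else {}) \<union> Suc ` colour_set m k (r mod 8 ^ m)"
proof (rule Set.set_eqI)
  fix p
  have "r div 8 ^ m < 8"
    using assms by (intro less_mult_imp_div_less) (simp add: mult.commute)
  then show "p \<in> colour_set (Suc m) k r \<longleftrightarrow>
      p \<in> (if has_colour k (r div 8 ^ m) then {0} else {}) \<union> Suc ` colour_set m k (r mod 8 ^ m)"
    by (cases p) (auto simp: colour_set_def digit_of_mod image_iff)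
qed

lemma mu_entry:
  assumes "d < 8" "e < 8"
  shows "mu $$ (d, e) = (if d = e then s ^ 3 * (\<Prod>k<3. if has_colour k d then - 1 else 1) else 0)"
proof -
  have "\<forall>d<8. \<forall>e<8. mu $$ (d, e) = (if d = e then s ^ 3 * (\<Prod>k<3. if has_colour k d then - 1 else 1) else 0)"
    unfolding prod_three_colours mu_def diag_mat_of_def
    by (rule all_digitsI; rule all_digitsI; simp add: has_colour_table[unfolded One_nat_def])
  then show ?thesis
    using assms by blast
qed

lemma mu_dim [simp]: "dim_row mu = 8" "dim_col mu = 8"
  by (simp_all add: mu_def diag_mat_of_def)

lemma kron_power_mu_dim [simp]: "dim_row (kron_power mu m) = 8 ^ m" "dim_col (kron_power mu m) = 8 ^ m"
  by (induction m) simp_all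

lemma div_mod_eq_iff: "(r div b = c div b \<and> r mod b = c mod b) \<longleftrightarrow> r = (c :: nat)"
  by (metis div_mult_mod_eq)

lemma prod_colour_set_Suc:
  assumes "r < 8 ^ Suc m"
  shows "(\<Prod>p\<in>colour_set (Suc m) k r. g p) =
    (if has_colour k (r div 8 ^ m) then g 0 else 1) * (\<Prod>p\<in>colour_set m k (r mod 8 ^ m). (g (Suc p) :: K))"
proof -
  have fin: "finite (colour_set m k (r mod 8 ^ m))"
    by (rule finite_subset[OF colour_set_subset finite_lessThan])
  let ?C = "colour_set m k (r mod 8 ^ m)"
  have shift: "(\<Prod>p\<in>Suc ` ?C. g p) = (\<Prod>p\<in>?C. g (Suc p))"
    by (subst prod.reindex) simp_all
  show ?thesis
  proof (cases "has_colour k (r div 8 ^ m)")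
    case True
    then have "colour_set (Suc m) k r = insert 0 (Suc ` ?C)"
      unfolding colour_set_Suc[OF assms] by simp
    moreover have "finite (Suc ` ?C)" "0 \<notin> Suc ` ?C"
      using fin by simp_all
    ultimately show ?thesis
      using True shift by (simp only: prod.insert if_True not_False_eq_True)
  next
    case False
    then show ?thesis
      unfolding colour_set_Suc[OF assms] using shift by simp
  qed
qed

lemma kron_power_mu_index:
  assumes "r < 8 ^ m" "c < 8 ^ m"
  shows "kron_power mu m $$ (r, c) = (if r = c then s ^ (3 * m) * (\<Prod>k<3. \<Prod>p\<in>colour_set m k r. - 1) else 0)"
  using assms
proof (induction m arbitrary: r c)
  case 0
  then show ?case by (simp add: colour_set_def)
next
  case (Suc m)
  have d: "x div 8 ^ m < 8" if "x < 8 ^ Suc m" for x :: nat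
    using that by (intro less_mult_imp_div_less) (simp add: mult.commute)
  have "kron_power mu (Suc m) $$ (r, c)
      = mu $$ (r div 8 ^ m, c div 8 ^ m) * kron_power mu m $$ (r mod 8 ^ m, c mod 8 ^ m)"
    using Suc.prems by (simp add: kron_index)
  also have "\<dots> = (if r div 8 ^ m = c div 8 ^ m \<and> r mod 8 ^ m = c mod 8 ^ m
      then s ^ (3 * Suc m) * (\<Prod>k<3. (if has_colour k (r div 8 ^ m) then - 1 else 1) * (\<Prod>p\<in>colour_set m k (r mod 8 ^ m). - 1)) else 0)"
    using Suc.prems by (simp add: Suc.IH mu_entry[OF d d] prod.distrib power_add)
  also have "\<dots> = (if r = c then s ^ (3 * Suc m) * (\<Prod>k<3. \<Prod>p\<in>colour_set (Suc m) k r. - 1) else 0)"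
    unfolding div_mod_eq_iff prod_colour_set_Suc[OF Suc.prems(1)] by (rule refl)
  finally show ?case .
qed

lemma weight_matrix_index:
  assumes rc: "r < 8 ^ Suc m" "c < 8 ^ Suc m"
  shows "kron (1\<^sub>m 8) (kron_power mu m) $$ (r, c) =
    (if r = c then s ^ (3 * m) * (\<Prod>k<3. \<Prod>p\<in>colour_set (Suc m) k r. if p = 0 then 1 else - 1) else 0)"
proof -
  have d: "x div 8 ^ m < 8" if "x < 8 ^ Suc m" for x :: nat
    using that by (intro less_mult_imp_div_less) (simp add: mult.commute)
  have "kron (1\<^sub>m 8) (kron_power mu m) $$ (r, c)
      = 1\<^sub>m 8 $$ (r div 8 ^ m, c div 8 ^ m) * kron_power mu m $$ (r mod 8 ^ m, c mod 8 ^ m)"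
    using rc by (simp add: kron_index)
  also have "\<dots> = (if r div 8 ^ m = c div 8 ^ m \<and> r mod 8 ^ m = c mod 8 ^ m
      then s ^ (3 * m) * (\<Prod>k<3. \<Prod>p\<in>colour_set m k (r mod 8 ^ m). - 1) else 0)"
    using d[OF rc(1)] d[OF rc(2)] by (simp add: kron_power_mu_index)
  also have "\<dots> = (if r = c then s ^ (3 * m) * (\<Prod>k<3. \<Prod>p\<in>colour_set (Suc m) k r. if p = 0 then 1 else - 1) else 0)"
    unfolding div_mod_eq_iff prod_colour_set_Suc[OF rc(1)] by simp
  finally show ?thesis .
qed

text \<open>The weight is diagonal and multiplicative over colours and strands, so the trace is the cube of
  a signed sum of principal minors of \<open>N\<close>.\<close>

lemma trace_three_exterior:
  assumes N: "N \<in> carrier_mat (Suc m) (Suc m)"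
  shows "mat_trace (kron (1\<^sub>m 8) (kron_power mu m) * three_exterior (Suc m) N)
    = s ^ (3 * m) * Determinant.det (Matrix.mat (Suc m) (Suc m)
        (\<lambda>(r, c). (if r = c then 1 else 0) + (if r = 0 then 1 else - 1) * N $$ (r, c))) ^ 3"
proof -
  let ?D = "kron (1\<^sub>m 8) (kron_power mu m)" and ?T = "three_exterior (Suc m) N"
  let ?g = "\<lambda>p :: nat. if p = 0 then 1 else - 1 :: K"
  have dims: "dim_row ?D = 8 ^ Suc m" "dim_col ?D = 8 ^ Suc m"
    "dim_row ?T = 8 ^ Suc m" "dim_col ?T = 8 ^ Suc m"
    by (simp_all add: three_exterior_def)
  have "(?D * ?T) $$ (r, r) = s ^ (3 * m) * (\<Prod>k<3. (\<Prod>p\<in>colour_set (Suc m) k r. ?g p)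
      * minor N (colour_set (Suc m) k r) (colour_set (Suc m) k r))" if r: "r < 8 ^ Suc m" for r
  proof -
    have "(?D * ?T) $$ (r, r) = (\<Sum>l<8 ^ Suc m. ?D $$ (r, l) * ?T $$ (l, r))"
      by (rule mult_mat_index[OF _ _ r r]) (use dims in \<open>auto intro: carrier_matI\<close>)
    also have "\<dots> = (\<Sum>l<8 ^ Suc m. if r = l then s ^ (3 * m) * (\<Prod>k<3. \<Prod>p\<in>colour_set (Suc m) k r. ?g p) * ?T $$ (r, r) else 0)"
      using r by (intro sum.cong refl) (simp add: weight_matrix_index)
    also have "\<dots> = s ^ (3 * m) * (\<Prod>k<3. \<Prod>p\<in>colour_set (Suc m) k r. ?g p) * ?T $$ (r, r)"
      using r by simp
    finally show ?thesis
      using r by (simp add: three_exterior_def prod.distrib mult.assoc)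
  qed
  then have "mat_trace (?D * ?T) = (\<Sum>r<8 ^ Suc m. s ^ (3 * m) * (\<Prod>k<3. (\<Prod>p\<in>colour_set (Suc m) k r. ?g p)
      * minor N (colour_set (Suc m) k r) (colour_set (Suc m) k r)))"
    unfolding mat_trace_def by (intro sum.cong) (simp_all add: dims)
  also have "\<dots> = s ^ (3 * m) * (\<Prod>k<3 :: nat. \<Sum>A\<in>Pow {..<Suc m}. (\<Prod>p\<in>A. ?g p) * minor N A A)"
    by (simp only: sum_over_colour_sets[of "\<lambda>k A. (\<Prod>p\<in>A. ?g p) * minor N A A"] sum_distrib_left[symmetric])
  also have "\<dots> = s ^ (3 * m) * Determinant.det (Matrix.mat (Suc m) (Suc m)
        (\<lambda>(r, c). (if r = c then 1 else 0) + ?g r * N $$ (r, c))) ^ 3"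
    by (simp only: sum_signed_principal_minors[OF N] prod_constant card_lessThan)
  finally show ?thesis .
qed

section \<open>The Burau representation and its dual\<close>

text \<open>The invariant vector \<open>\<delta>\<^sub>n\<close> that is divided out in \<open>burau_quot\<close>.\<close>

definition delta :: "nat \<Rightarrow> K Matrix.vec" where
  "delta n = Matrix.vec n (\<lambda>p. inverse s ^ (n - 1 - p))"

lemma delta_carrier [simp]: "delta n \<in> carrier_vec n"
  by (simp add: delta_def)

lemma delta_step: "Suc i < n \<Longrightarrow> vec_index (delta n) i = inverse s * vec_index (delta n) (Suc i)"
  by (simp add: delta_def Suc_diff_Suc flip: power_Suc)

text \<open>The Gram matrix of a form on the Burau module that is sesquilinear for \<open>s \<mapsto> s\<^sup>-\<^sup>1\<close> and invariant
  under braids, a relative of Squier's hermitian form. Being lower unitriangular, it has determinant 1,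
  and its first row is the first unit covector.\<close>

definition burau_duality :: "nat \<Rightarrow> K mat" where
  "burau_duality n = Matrix.mat n n (\<lambda>(r, c).
     if r = c then 1 else if c < r then Y * s ^ (r - c - 1) else 0)"

lemma burau_duality_carrier [simp]: "burau_duality n \<in> carrier_mat n n"
  by (simp add: burau_duality_def)

lemma det_burau_duality: "Determinant.det (burau_duality n) = 1"
proof -
  have "Determinant.det (burau_duality n) = prod_list (diag_mat (burau_duality n))"
    by (rule det_lower_triangular[of n]) (auto simp: burau_duality_def)
  also have "diag_mat (burau_duality n) = replicate n 1"
    by (rule nth_equalityI) (auto simp: diag_mat_def burau_duality_def)
  finally show ?thesis by simp
qed

abbreviation burau_gen_inverse :: "nat \<Rightarrow> nat \<Rightarrow> K mat" where
  "burau_gen_inverse n i \<equiv> two_strand_mat 0 (inverse s) (inverse s) stay_weight n (i - 1)"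

lemma burau_gen_two_strand:
  assumes "1 \<le> i" "i < n"
  shows "burau_gen n i = two_strand_mat (1 - t) s s 0 n (i - 1)"
  using assms by (intro eq_matI) (auto simp: burau_gen_def two_strand_mat_def)

lemma burau_gen_carrier [simp]: "burau_gen n i \<in> carrier_mat n n"
  by (simp add: burau_gen_def)

lemma burau_gen_inverse:
  assumes "1 \<le> i" "i < n"
  shows "burau_gen n i * burau_gen_inverse n i = 1\<^sub>m n"
  using assms unfolding burau_gen_two_strand[OF assms]
  by (subst two_strand_mat_mult) (simp_all add: weight_relation two_strand_mat_one)

lemma transpose_two_strand_mat:
  "transpose_mat (two_strand_mat a b a' b' n i) = two_strand_mat a a' b b' n i"
  by (rule eq_matI) (auto simp: two_strand_mat_def)

lemma two_strand_mat_mult_vec: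
  assumes i: "Suc i < n" and v: "v \<in> carrier_vec n"
    and "a * vec_index v i + b * vec_index v (Suc i) = vec_index v i" "a' * vec_index v i + b' * vec_index v (Suc i) = vec_index v (Suc i)"
  shows "two_strand_mat a b a' b' n i *\<^sub>v v = v"
proof (rule eq_vecI)
  let ?T = "two_strand_mat a b a' b' n i"
  fix r assume "r < dim_vec v"
  then have r: "r < n" using v by simp
  have "vec_index (?T *\<^sub>v v) r = (\<Sum>k<n. ?T $$ (r, k) * vec_index v k)"
    using v r by (auto simp: scalar_prod_def atLeast0LessThan intro!: sum.cong)
  also have "\<dots> = (\<Sum>k\<in>{r, i, Suc i}. ?T $$ (r, k) * vec_index v k)"
    by (rule sum.mono_neutral_right) (use r i in \<open>auto simp: two_strand_mat_def\<close>)
  also have "\<dots> = vec_index v r"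
  proof -
    consider "r = i" | "r = Suc i" | "r \<noteq> i" "r \<noteq> Suc i" by blast
    then show ?thesis
      by cases (use r i assms(3,4) in
        \<open>simp_all add: two_strand_mat_def insert_commute[of "Suc i" i] add.commute\<close>)
  qed
  finally show "vec_index (?T *\<^sub>v v) r = vec_index v r" .
qed (use v in simp)

lemma burau_gen_fixes_delta:
  assumes "1 \<le> i" "i < n"
  shows "burau_gen n i *\<^sub>v delta n = delta n"
  unfolding burau_gen_two_strand[OF assms]
  using assms delta_step[of "i - 1" n]
  by (intro two_strand_mat_mult_vec) (simp_all add: t_def algebra_simps power2_eq_square)

lemma burau_gen_inverse_fixes_delta:
  assumes "1 \<le> i" "i < n"
  shows "burau_gen_inverse n i *\<^sub>v delta n = delta n"
  using assms delta_step[of "i - 1" n]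
  by (intro two_strand_mat_mult_vec) (simp_all add: stay_weight_def inverse_t algebra_simps power2_eq_square)

text \<open>The Burau matrices are symmetric, so the right-hand side contains the inverse transpose of the
  Burau matrix of the generator. Rows and columns of the duality matrix are geometric progressions below
  the diagonal and therefore fixed by the local matrices away from the diagonal; only the \<open>2 \<times> 2\<close> block on
  the diagonal needs the value \<open>Y\<close>.\<close>

lemma burau_duality_intertwines:
  assumes i: "1 \<le> i" "i < n"
  shows "burau_duality n * dual_burau_gen n i = burau_gen_inverse n i * burau_duality n"
proof (rule eq_matI)
  let ?Q = "burau_duality n" and ?w = "inverse s"
  define l where "l = i - 1"
  have l: "Suc l < n" using i by (simp add: l_def)
  fix r c assume "r < dim_row (burau_gen_inverse n i * ?Q)" "c < dim_col (burau_gen_inverse n i * ?Q)"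
  then have rc: "r < n" "c < n" by (simp_all add: burau_duality_def)
  have Q: "?Q $$ (p, q) = (if p = q then 1 else if q < p then Y * s ^ (p - q - 1) else 0)" if "p < n" "q < n" for p q
    using that by (simp add: burau_duality_def)
  have Qrow: "?Q $$ (Suc l, q) = s * ?Q $$ (l, q)" if "q < l" for q
  proof -
    have "Suc l - q - 1 = Suc (l - q - 1)" using that by simp
    then show ?thesis using that l by (simp add: Q)
  qed
  have Qcol: "?Q $$ (p, l) = s * ?Q $$ (p, Suc l)" if "Suc l < p" "p < n" for p
  proof -
    have "p - l - 1 = Suc (p - Suc l - 1)" using that by simp
    then show ?thesis using that l by (simp add: Q)
  qed
  have corner: "?Q $$ (l, l) = 1" "?Q $$ (Suc l, Suc l) = 1" "?Q $$ (l, Suc l) = 0" "?Q $$ (Suc l, l) = Y"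
    using l by (simp_all add: Q)
  have rel: "stay_weight * s + ?w = s" "?w * s = 1" "Y * ?w = stay_weight" "stay_weight + ?w * ?w = 1"
    by (simp_all add: stay_weight_def Y_def t_def field_simps power2_eq_square)
  have L: "(?Q * dual_burau_gen n i) $$ (r, c) = (if c = l then ?Q $$ (r, l) * stay_weight + ?Q $$ (r, Suc l) * ?w
      else if c = Suc l then ?Q $$ (r, l) * ?w else ?Q $$ (r, c))"
    unfolding dual_burau_gen_def l_def[symmetric]
    by (subst mult_two_strand_mat_index[OF burau_duality_carrier l rc]) simp
  have R: "(burau_gen_inverse n i * ?Q) $$ (r, c) = (if r = l then ?w * ?Q $$ (Suc l, c)
      else if r = Suc l then ?w * ?Q $$ (l, c) + stay_weight * ?Q $$ (Suc l, c) else ?Q $$ (r, c))"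
    unfolding l_def[symmetric]
    by (subst two_strand_mat_mult_index[OF burau_duality_carrier l rc]) simp
  have upper: "?Q $$ (p, q) = 0" if "p < q" "q < n" for p q
    using that by (simp add: Q)
  consider "r = l" | "r = Suc l" | "r < l" | "Suc l < r" by linarith
  then show "(?Q * dual_burau_gen n i) $$ (r, c) = (burau_gen_inverse n i * ?Q) $$ (r, c)"
  proof cases
    case 1
    consider "c = l" | "c = Suc l" | "c < l" | "Suc l < c" by linarith
    then show ?thesis
      unfolding L R using 1 rc l rel
      by cases (simp_all add: corner Qrow upper mult.commute[of "inverse s" Y])
  next
    case 2
    consider "c = l" | "c = Suc l" | "c < l" | "Suc l < c" by linarith
    then show ?thesis
    proof cases
      case 3
      have "?w * ?Q $$ (l, c) + stay_weight * (s * ?Q $$ (l, c)) = (stay_weight * s + ?w) * ?Q $$ (l, c)"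
        by (simp add: algebra_simps)
      then show ?thesis
        unfolding L R using 2 3 rel(1) by (simp add: Qrow)
    qed (unfold L R, use 2 rc l rel in \<open>simp_all add: corner upper mult.commute\<close>)
  next
    case 3
    then show ?thesis
      unfolding L R using rc l by (simp add: upper)
  next
    case 4
    define q where "q = ?Q $$ (r, Suc l)"
    have "s * q * stay_weight + q * ?w = (stay_weight * s + ?w) * q"
      by (simp add: algebra_simps)
    moreover have "s * q * ?w = q"
      by simp
    ultimately show ?thesis
      unfolding L R using 4 rc rel(1) Qcol[OF 4 rc(1)] by (simp add: q_def)
  qed
qed (simp_all add: burau_duality_def dual_burau_gen_def)

lemma minor_full:
  assumes "M \<in> carrier_mat n n"
  shows "minor M {..<n} {..<n} = Determinant.det M"
proof -
  have "filter (\<lambda>i. i \<in> {..<n}) [0..<n] = [0..<n]"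
    by (simp add: filter_id_conv)
  then show ?thesis
    using assms unfolding minor_def det_rows_def
    by (auto intro!: arg_cong[where f = Determinant.det] eq_matI)
qed

text \<open>The determinant is the top exterior power, hence the fully occupied local weight.\<close>

lemma det_burau_gen:
  assumes "1 \<le> i" "i < n"
  shows "Determinant.det (burau_gen n i) = - t"
proof -
  have i': "Suc (i - 1) < n" using assms by simp
  have "Determinant.det (burau_gen n i) = minor (local_mat s (1 - t) n (i - 1) * 1\<^sub>m n) {..<n} {..<n}"
    by (simp add: burau_gen_two_strand[OF assms] minor_full)
  also have "\<dots> = - t"
    unfolding minor_local_mat[OF one_carrier_mat i'] using assms
    by (auto simp: minor_full local_weight_def t_def)
  finally show ?thesis .
qed

text \<open>The units that occur in the comparison of the two invariants.\<close>

definition t_monomials :: "K set" where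
  "t_monomials = {\<epsilon> * t ^ j / t ^ k | \<epsilon> j k. \<epsilon> = 1 \<or> \<epsilon> = - 1}"

lemma t_monomials_mult: "x \<in> t_monomials \<Longrightarrow> y \<in> t_monomials \<Longrightarrow> x * y \<in> t_monomials"
proof -
  assume "x \<in> t_monomials" "y \<in> t_monomials"
  then obtain e j k e' j' k' where xy: "e = 1 \<or> e = - 1" "e' = 1 \<or> e' = - 1"
    "x = e * t ^ j / t ^ k" "y = e' * t ^ j' / t ^ k'"
    unfolding t_monomials_def by blast
  have "x * y = (e * e') * t ^ (j + j') / t ^ (k + k')"
    unfolding xy(3,4) by (simp add: power_add)
  moreover have "e * e' = 1 \<or> e * e' = - 1" using xy(1,2) by auto
  ultimately show ?thesis
    unfolding t_monomials_def by blast
qed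

lemma t_monomials_basic: "1 \<in> t_monomials" "- 1 \<in> t_monomials" "- t \<in> t_monomials" "t \<in> t_monomials"
  "- inverse t \<in> t_monomials"
proof -
  have *: "e * t ^ j / t ^ k \<in> t_monomials" if "e = 1 \<or> e = - 1" for e j k
    using that unfolding t_monomials_def by blast
  show "1 \<in> t_monomials" using *[of 1 0 0] by simp
  show "- 1 \<in> t_monomials" using *[of "- 1" 0 0] by simp
  show "- t \<in> t_monomials" using *[of "- 1" 1 0] by simp
  show "t \<in> t_monomials" using *[of 1 1 0] by simp
  show "- inverse t \<in> t_monomials" using *[of "- 1" 0 1] by (simp add: divide_inverse)
qed

lemma t_monomials_power: "x \<in> t_monomials \<Longrightarrow> x ^ k \<in> t_monomials"
  by (induction k) (simp_all add: t_monomials_basic t_monomials_mult)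

lemma burau_letter:
  fixes e :: bool
  assumes i: "1 \<le> i" "i < n"
  defines "X \<equiv> (if e then burau_gen n i else the (mat_inverse (burau_gen n i)))"
  defines "V \<equiv> (if e then burau_gen_inverse n i else burau_gen n i)"
  defines "Z \<equiv> (if e then dual_burau_gen n i else the (mat_inverse (dual_burau_gen n i)))"
  shows "X \<in> carrier_mat n n" "V \<in> carrier_mat n n" "Z \<in> carrier_mat n n"
    "X * V = 1\<^sub>m n" "V * X = 1\<^sub>m n" "transpose_mat X = X" "transpose_mat V = V"
    "X *\<^sub>v delta n = delta n" "Determinant.det V \<in> t_monomials"
    "burau_duality n * Z = V * burau_duality n"
proof -
  let ?B = "burau_gen n i" and ?I = "burau_gen_inverse n i" and ?Q = "burau_duality n"
  let ?P = "dual_burau_gen n i" and ?P' = "two_strand_mat 0 s s (1 - t) n (i - 1)"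
  have P: "?P \<in> carrier_mat n n" by (simp add: dual_burau_gen_def)
  have BI: "?B * ?I = 1\<^sub>m n" by (rule burau_gen_inverse[OF i])
  have IB: "?I * ?B = 1\<^sub>m n"
    by (rule mat_mult_left_right_inverse[OF _ _ BI]) simp_all
  have inv: "the (mat_inverse ?B) = ?I" "the (mat_inverse ?P) = ?P'"
    using the_mat_inverse[OF _ _ BI] the_mat_inverse[OF P _ dual_burau_gen_inverse[OF i]] by simp_all
  show "X \<in> carrier_mat n n" "V \<in> carrier_mat n n" "Z \<in> carrier_mat n n"
    using P by (simp_all add: X_def V_def Z_def inv)
  show "X * V = 1\<^sub>m n" "V * X = 1\<^sub>m n"
    using BI IB by (simp_all add: X_def V_def inv)
  have "transpose_mat ?B = ?B"
    by (simp add: burau_gen_two_strand[OF i] transpose_two_strand_mat)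
  then show "transpose_mat X = X" "transpose_mat V = V"
    by (simp_all add: X_def V_def inv transpose_two_strand_mat)
  show "X *\<^sub>v delta n = delta n"
    using burau_gen_fixes_delta[OF i] burau_gen_inverse_fixes_delta[OF i] by (simp add: X_def inv)
  have "Determinant.det ?B * Determinant.det ?I = 1"
    using det_mult[of ?B n ?I] unfolding BI by simp
  then have "- t * Determinant.det ?I = 1"
    by (simp only: det_burau_gen[OF i])
  moreover have "Determinant.det ?I = - inverse t * (- t * Determinant.det ?I)"
    by simp
  ultimately have "Determinant.det ?I = - inverse t"
    by (simp only: mult_1_right)
  then show "Determinant.det V \<in> t_monomials"
    using det_burau_gen[OF i] by (simp add: V_def t_monomials_basic)
  show "?Q * Z = V * ?Q"
  proof (cases e)
    case True
    then show ?thesis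
      using burau_duality_intertwines[OF i] by (simp add: Z_def V_def)
  next
    case False
    have B: "?B \<in> carrier_mat n n" and I: "?I \<in> carrier_mat n n" and Q: "?Q \<in> carrier_mat n n"
      and P': "?P' \<in> carrier_mat n n"
      by simp_all
    note assoc = assoc_mult_mat[of _ n n _ n _ n] and QP' = mult_carrier_mat[OF Q P']
    have "?B * ?Q = ?B * (?Q * (?P * ?P'))"
      unfolding dual_burau_gen_inverse[OF i] by (simp only: right_mult_one_mat[OF Q])
    also have "\<dots> = ?B * ((?Q * ?P) * ?P')"
      by (simp only: assoc[OF Q P P'])
    also have "\<dots> = ?B * ((?I * ?Q) * ?P')"
      by (simp only: burau_duality_intertwines[OF i])
    also have "\<dots> = (?B * ?I) * (?Q * ?P')"
      by (simp only: assoc[OF I Q P'] assoc[OF B I QP'])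
    also have "\<dots> = ?Q * ?P'"
      unfolding BI by (rule left_mult_one_mat[OF QP'])
    finally show ?thesis
      using False by (simp add: Z_def V_def inv)
  qed
qed

text \<open>The inverse \<open>W\<close> of the Burau matrix is carried along explicitly. The vector \<open>\<delta>\<^sub>n\<close> is fixed on both
  sides because the matrices of the letters are symmetric.\<close>

lemma burau_properties:
  assumes "is_braid n b"
  shows "\<exists>W. burau n b \<in> carrier_mat n n \<and> W \<in> carrier_mat n n \<and> dual_burau n b \<in> carrier_mat n n
    \<and> burau n b * W = 1\<^sub>m n \<and> Determinant.det W \<in> t_monomials
    \<and> burau n b *\<^sub>v delta n = delta n \<and> transpose_mat (burau n b) *\<^sub>v delta n = delta n
    \<and> burau_duality n * dual_burau n b = transpose_mat W * burau_duality n"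
  using assms
proof (induction b)
  case Nil
  show ?case
    by (rule exI[of _ "1\<^sub>m n"]) (simp add: burau_def dual_burau_def t_monomials_basic
        left_mult_one_mat[of _ n n] right_mult_one_mat[of _ n n])
next
  case (Cons l b)
  obtain i e where l: "l = (i, e)" by (cases l)
  have i: "1 \<le> i" "i < n" and b: "is_braid n b"
    using Cons.prems unfolding l is_braid_Cons by auto
  define X where "X = (if e then burau_gen n i else the (mat_inverse (burau_gen n i)))"
  define V where "V = (if e then burau_gen_inverse n i else burau_gen n i)"
  define Z where "Z = (if e then dual_burau_gen n i else the (mat_inverse (dual_burau_gen n i)))"
  note letter = burau_letter[OF i, of e, folded X_def V_def Z_def]
  let ?M = "burau n b" and ?N = "dual_burau n b" and ?Q = "burau_duality n"
  obtain W where W: "?M \<in> carrier_mat n n" "W \<in> carrier_mat n n" "?N \<in> carrier_mat n n"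
    "?M * W = 1\<^sub>m n" "Determinant.det W \<in> t_monomials"
    "?M *\<^sub>v delta n = delta n" "transpose_mat ?M *\<^sub>v delta n = delta n" "?Q * ?N = transpose_mat W * ?Q"
    using Cons.IH[OF b] by blast
  have eqs: "burau n (l # b) = X * ?M" "dual_burau n (l # b) = Z * ?N"
    by (simp_all add: l burau_def dual_burau_def X_def Z_def)
  note assoc = assoc_mult_mat[of _ n n _ n _ n]
  note closed = mult_carrier_mat[of _ n n _ n] transpose_carrier_mat
  note car = letter(1-3) W(1-3)
  have tW: "transpose_mat W \<in> carrier_mat n n" "transpose_mat ?M \<in> carrier_mat n n"
    using W by simp_all
  have "(X * ?M) * (W * V) = X * ((?M * W) * V)"
    using car by (simp add: assoc closed)
  then have a: "(X * ?M) * (W * V) = 1\<^sub>m n"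
    using car letter(4) W(4) by simp
  have b: "Determinant.det (W * V) \<in> t_monomials"
    using car det_mult[of W n V] t_monomials_mult[OF W(5) letter(9)] by simp
  have c: "(X * ?M) *\<^sub>v delta n = delta n"
    using car letter(8) W(6) by (simp add: assoc_mult_mat_vec[of _ n n _ n])
  have "transpose_mat (X * ?M) = transpose_mat ?M * X"
    using transpose_mult[OF letter(1) W(1)] letter(6) by simp
  then have d: "transpose_mat (X * ?M) *\<^sub>v delta n = delta n"
    using car tW letter(8) W(7) by (simp add: assoc_mult_mat_vec[of _ n n _ n])
  have "?Q * (Z * ?N) = (?Q * Z) * ?N"
    using car by (simp add: assoc)
  also have "\<dots> = V * (?Q * ?N)"
    using car by (simp add: assoc letter(10))
  also have "\<dots> = (V * transpose_mat W) * ?Q"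
    using car tW by (simp add: assoc W(8))
  also have "V * transpose_mat W = transpose_mat (W * V)"
    using transpose_mult[OF W(2) letter(2)] letter(7) by simp
  finally have e: "?Q * (Z * ?N) = transpose_mat (W * V) * ?Q" .
  show ?case
    unfolding eqs using a b c d e car by (intro exI[of _ "W * V"]) (simp add: closed)
qed

section \<open>Both invariants as multiples of one minor\<close>

lemma one_minus_annihilates_delta:
  assumes A: "A \<in> carrier_mat (Suc m) (Suc m)" and fixed: "A *\<^sub>v delta (Suc m) = delta (Suc m)" and r: "r \<le> m"
  shows "(\<Sum>c\<le>m. (1\<^sub>m (Suc m) - A) $$ (r, c) * inverse s ^ (m - c)) = 0"
proof -
  have "vec_index (A *\<^sub>v delta (Suc m)) r = (\<Sum>c<Suc m. A $$ (r, c) * inverse s ^ (m - c))"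
    using A r by (auto simp: scalar_prod_def atLeast0LessThan delta_def intro!: sum.cong)
  then have AA: "(\<Sum>c\<le>m. A $$ (r, c) * inverse s ^ (m - c)) = inverse s ^ (m - r)"
    unfolding fixed using r by (simp add: delta_def lessThan_Suc_atMost)
  have "(\<Sum>c\<le>m. (1\<^sub>m (Suc m) - A) $$ (r, c) * inverse s ^ (m - c))
      = (\<Sum>c\<le>m. (if r = c then inverse s ^ (m - c) else 0) - A $$ (r, c) * inverse s ^ (m - c))"
    using A r by (intro sum.cong) (auto simp: algebra_simps)
  also have "\<dots> = 0"
    unfolding sum_subtractf AA using r by simp
  finally show ?thesis .
qed

lemma delta_annihilates_one_minus:
  assumes A: "A \<in> carrier_mat (Suc m) (Suc m)"
    and fixed: "transpose_mat A *\<^sub>v delta (Suc m) = delta (Suc m)" and c: "c \<le> m"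
  shows "(\<Sum>r\<le>m. inverse s ^ (m - r) * (1\<^sub>m (Suc m) - A) $$ (r, c)) = 0"
proof -
  have "(\<Sum>r\<le>m. (1\<^sub>m (Suc m) - transpose_mat A) $$ (c, r) * inverse s ^ (m - r)) = 0"
    using A fixed c by (intro one_minus_annihilates_delta) simp_all
  moreover have "(1\<^sub>m (Suc m) - transpose_mat A) $$ (c, r) = (1\<^sub>m (Suc m) - A) $$ (r, c)" if "r \<le> m" for r
    using A c that by simp
  ultimately show ?thesis
    by (simp add: mult.commute)
qed

text \<open>The minor of \<open>1 - M\<close> in which the last row and column are deleted; the Alexander polynomial and the
  trace are both expressed by it.\<close>

definition corner_minor :: "nat \<Rightarrow> K mat \<Rightarrow> K" where
  "corner_minor m M = Determinant.det (Matrix.mat m m (\<lambda>(r, c). (1\<^sub>m (Suc m) - M) $$ (r, c)))"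

lemma corner_minor_transpose:
  assumes M: "M \<in> carrier_mat (Suc m) (Suc m)"
  shows "corner_minor m (transpose_mat M) = corner_minor m M"
proof -
  let ?X = "Matrix.mat m m (\<lambda>(r, c). (1\<^sub>m (Suc m) - M) $$ (r, c))"
  have "Matrix.mat m m (\<lambda>(r, c). (1\<^sub>m (Suc m) - transpose_mat M) $$ (r, c)) = transpose_mat ?X"
    using M by (intro eq_matI) auto
  then show ?thesis
    unfolding corner_minor_def by (simp only: det_transpose[of ?X m] mat_carrier)
qed

text \<open>The pairing of \<open>\<delta>\<close> with the first column of the duality matrix. It cancels the first entry of
  \<open>\<delta>\<close>, so no further factor enters the comparison.\<close>

lemma delta_duality_sum:
  "(\<Sum>r\<le>m. inverse s ^ (m - r) * (if r = 0 then 1 else Y * s ^ (r - 1))) = s ^ m"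
proof (induction m)
  case 0
  show ?case by simp
next
  case (Suc m)
  let ?q = "\<lambda>r. if r = 0 then 1 else Y * s ^ (r - 1)"
  have "(\<Sum>r\<le>Suc m. inverse s ^ (Suc m - r) * ?q r) = (\<Sum>r\<le>m. inverse s * (inverse s ^ (m - r) * ?q r)) + Y * s ^ m"
    by (auto simp: Suc_diff_le intro!: sum.cong)
  also have "\<dots> = inverse s * s ^ m + Y * s ^ m"
    by (simp only: sum_distrib_left[symmetric] Suc.IH)
  also have "\<dots> = s ^ Suc m"
    by (simp add: Y_def algebra_simps)
  finally show ?case .
qed

text \<open>With \<open>D = 2 e\<^sub>1 e\<^sub>1\<^sup>T\<close>, the matrix is \<open>1 - N + D N\<close>. Multiplication by the duality matrix \<open>Q\<close> turns \<open>N\<close>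
  into \<open>W\<^sup>T\<close>, and \<open>D Q = D\<close> since the first row of \<open>Q\<close> is \<open>e\<^sub>1\<^sup>T\<close>. Multiplication by \<open>M\<^sup>T\<close> then cancels
  \<open>W\<^sup>T\<close> and leaves \<open>M\<^sup>T - 1 + Q D\<close>, the negative of a rank-one perturbation of the singular matrix \<open>1 - M\<^sup>T\<close>.\<close>

lemma det_signed_dual:
  assumes M: "M \<in> carrier_mat (Suc m) (Suc m)" and N: "N \<in> carrier_mat (Suc m) (Suc m)"
    and W: "W \<in> carrier_mat (Suc m) (Suc m)" and MW: "M * W = 1\<^sub>m (Suc m)"
    and right: "M *\<^sub>v delta (Suc m) = delta (Suc m)" and left: "transpose_mat M *\<^sub>v delta (Suc m) = delta (Suc m)"
    and dual: "burau_duality (Suc m) * N = transpose_mat W * burau_duality (Suc m)"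
  shows "Determinant.det (Matrix.mat (Suc m) (Suc m)
      (\<lambda>(r, c). (if r = c then 1 else 0) + (if r = 0 then 1 else - 1) * N $$ (r, c)))
    = 2 * ((- 1) ^ m * Determinant.det W * corner_minor m M)"
    (is "Determinant.det ?E = _")
proof -
  let ?n = "Suc m" and ?Q = "burau_duality (Suc m)" and ?W = "transpose_mat W" and ?M = "transpose_mat M"
  let ?D = "Matrix.mat (Suc m) (Suc m) (\<lambda>(r, c). if r = 0 \<and> c = 0 then 2 else 0) :: K mat"
  define F where "F = (1\<^sub>m ?n - ?W) + (?Q * ?D) * ?W"
  have D: "?D \<in> carrier_mat ?n ?n" and Q: "?Q \<in> carrier_mat ?n ?n" and W': "?W \<in> carrier_mat ?n ?n"
    and M': "?M \<in> carrier_mat ?n ?n"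
    using W M by simp_all
  have QDc: "?Q * ?D \<in> carrier_mat ?n ?n" and QDWc: "?Q * ?D * ?W \<in> carrier_mat ?n ?n"
    using mult_carrier_mat[OF Q D] mult_carrier_mat[OF mult_carrier_mat[OF Q D] W'] by simp_all
  have DN: "?D * N \<in> carrier_mat ?n ?n" and oN: "1\<^sub>m ?n - N \<in> carrier_mat ?n ?n"
    and oW: "1\<^sub>m ?n - ?W \<in> carrier_mat ?n ?n"
    using mult_carrier_mat[OF D N] minus_carrier_mat[OF N] minus_carrier_mat[OF W'] by simp_all
  note assoc = assoc_mult_mat[of _ ?n ?n _ ?n _ ?n]
  have row0: "(?D * A) $$ (r, c) = (if r = 0 then 2 * A $$ (0, c) else 0)"
    if A: "A \<in> carrier_mat ?n ?n" and rc: "r < ?n" "c < ?n" for A r c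
  proof -
    have "(?D * A) $$ (r, c) = (\<Sum>l<?n. ?D $$ (r, l) * A $$ (l, c))"
      by (rule mult_mat_index[OF D A rc])
    also have "\<dots> = (\<Sum>l<?n. if l = 0 then (if r = 0 then 2 * A $$ (0, c) else 0) else 0)"
      using rc by (intro sum.cong) auto
    finally show ?thesis by simp
  qed
  have DQ: "?D * ?Q = ?D"
  proof (rule eq_matI)
    fix r c assume "r < dim_row ?D" "c < dim_col ?D"
    then have rc: "r < ?n" "c < ?n" by simp_all
    show "(?D * ?Q) $$ (r, c) = ?D $$ (r, c)"
      unfolding row0[OF Q rc] using rc by (simp add: burau_duality_def)
  qed (simp_all add: burau_duality_def)
  have E: "?E = (1\<^sub>m ?n - N) + ?D * N"
  proof (rule eq_matI)
    fix r c assume "r < dim_row ((1\<^sub>m ?n - N) + ?D * N)" "c < dim_col ((1\<^sub>m ?n - N) + ?D * N)"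
    then have rc: "r < ?n" "c < ?n" using N by simp_all
    have "((1\<^sub>m ?n - N) + ?D * N) $$ (r, c) = (1\<^sub>m ?n - N) $$ (r, c) + (?D * N) $$ (r, c)"
      using rc N D by (intro index_add_mat) simp_all
    then show "?E $$ (r, c) = ((1\<^sub>m ?n - N) + ?D * N) $$ (r, c)"
      unfolding row0[OF N rc] using rc N by simp
  qed (use N in simp_all)
  have "?Q * (?D * N) = ?Q * ((?D * ?Q) * N)"
    by (simp only: DQ)
  also have "\<dots> = ?Q * (?D * (?Q * N))"
    by (simp only: assoc[OF D Q N])
  also have "\<dots> = (?Q * ?D) * (?W * ?Q)"
    unfolding dual by (rule assoc[OF Q D, symmetric]) (use W' Q in simp)
  also have "\<dots> = ((?Q * ?D) * ?W) * ?Q"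
    by (rule assoc[OF QDc W' Q, symmetric])
  finally have QDN: "?Q * (?D * N) = ((?Q * ?D) * ?W) * ?Q" .
  have "?Q * ?E = ?Q * (1\<^sub>m ?n - N) + ?Q * (?D * N)"
    unfolding E by (rule mult_add_distrib_mat[OF Q oN DN])
  also have "?Q * (1\<^sub>m ?n - N) = ?Q * 1\<^sub>m ?n - ?Q * N"
    by (rule mult_minus_distrib_mat[of _ ?n ?n _ ?n]) (use Q N in simp_all)
  also have "\<dots> = 1\<^sub>m ?n * ?Q - ?W * ?Q"
    unfolding dual right_mult_one_mat[OF Q] left_mult_one_mat[OF Q] by (rule refl)
  also have "\<dots> = (1\<^sub>m ?n - ?W) * ?Q"
    by (rule minus_mult_distrib_mat[of _ ?n ?n _ _ ?n, symmetric]) (use Q W' in simp_all)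
  also have "(1\<^sub>m ?n - ?W) * ?Q + ?Q * (?D * N) = F * ?Q"
    unfolding QDN F_def by (rule add_mult_distrib_mat[of _ ?n ?n _ _ ?n, symmetric]) (use Q oW QDWc in simp_all)
  finally have QE: "?Q * ?E = F * ?Q" .
  have F: "F \<in> carrier_mat ?n ?n"
    using W' QDWc unfolding F_def by simp
  have "Determinant.det (?Q * ?E) = Determinant.det (F * ?Q)"
    by (simp only: QE)
  then have detE: "Determinant.det ?E = Determinant.det F"
    using det_mult[OF Q, of ?E] det_mult[OF F Q] by (simp add: det_burau_duality)
  have WM: "?W * ?M = 1\<^sub>m ?n"
    using transpose_mult[OF M W] by (simp add: MW)
  let ?G = "Matrix.mat ?n ?n (\<lambda>(r, c). (1\<^sub>m ?n - ?M) $$ (r, c) + ?Q $$ (r, 0) * (if c = 0 then - 2 else 0))"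
  have "F * ?M = (1\<^sub>m ?n - ?W) * ?M + ((?Q * ?D) * ?W) * ?M"
    unfolding F_def by (rule add_mult_distrib_mat[of _ ?n ?n _ _ ?n]) (use oW QDWc M' in simp_all)
  also have "(1\<^sub>m ?n - ?W) * ?M = 1\<^sub>m ?n * ?M - ?W * ?M"
    by (rule minus_mult_distrib_mat[of _ ?n ?n _ _ ?n]) (use M' W' in simp_all)
  also have "\<dots> = ?M - 1\<^sub>m ?n"
    unfolding WM left_mult_one_mat[OF M'] by (rule refl)
  also have "((?Q * ?D) * ?W) * ?M = (?Q * ?D) * (?W * ?M)"
    by (rule assoc[OF QDc W' M'])
  also have "\<dots> = ?Q * ?D"
    unfolding WM using QDc by (rule right_mult_one_mat)
  finally have FM: "F * ?M = (?M - 1\<^sub>m ?n) + ?Q * ?D" .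
  have QD: "(?Q * ?D) $$ (r, c) = (if c = 0 then 2 * ?Q $$ (r, 0) else 0)" if rc: "r < ?n" "c < ?n" for r c
  proof -
    have "(?Q * ?D) $$ (r, c) = (\<Sum>l<?n. ?Q $$ (r, l) * ?D $$ (l, c))"
      by (rule mult_mat_index[OF Q D rc])
    also have "\<dots> = (\<Sum>l<?n. if l = 0 then (if c = 0 then 2 * ?Q $$ (r, 0) else 0) else 0)"
      using rc by (intro sum.cong) auto
    finally show ?thesis by simp
  qed
  have "F * ?M = (- 1) \<cdot>\<^sub>m ?G"
    unfolding FM
  proof (rule eq_matI)
    fix r c assume "r < dim_row ((- 1) \<cdot>\<^sub>m ?G)" "c < dim_col ((- 1) \<cdot>\<^sub>m ?G)"
    then have rc: "r < ?n" "c < ?n" by simp_all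
    have "(?M - 1\<^sub>m ?n + ?Q * ?D) $$ (r, c) = (?M - 1\<^sub>m ?n) $$ (r, c) + (?Q * ?D) $$ (r, c)"
      using rc Q D by (intro index_add_mat) (simp_all add: burau_duality_def)
    then show "(?M - 1\<^sub>m ?n + ?Q * ?D) $$ (r, c) = ((- 1) \<cdot>\<^sub>m ?G) $$ (r, c)"
      unfolding QD[OF rc] using rc M by simp
  qed (use M' in \<open>simp_all add: burau_duality_def\<close>)
  then have d1: "Determinant.det (F * ?M) = (- 1) ^ ?n * Determinant.det ?G"
    by simp
  have d2: "Determinant.det ?G = (\<Sum>r\<le>m. inverse s ^ (m - r) * ?Q $$ (r, 0)) *
      (\<Sum>c\<le>m. inverse s ^ (m - c) * (if c = 0 then - 2 else 0)) * corner_minor m ?M"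
    unfolding corner_minor_def
  proof (rule det_corank_one_plus_rank_one)
    show "(\<Sum>c\<le>m. (1\<^sub>m ?n - ?M) $$ (r, c) * inverse s ^ (m - c)) = 0" if "r \<le> m" for r
      by (rule one_minus_annihilates_delta[OF M' left that])
    show "(\<Sum>r\<le>m. inverse s ^ (m - r) * (1\<^sub>m ?n - ?M) $$ (r, c)) = 0" if "c \<le> m" for c
      by (rule delta_annihilates_one_minus[OF M' _ that]) (use right in simp)
  qed (simp_all add: minus_carrier_mat[OF M'])
  have d3: "(\<Sum>r\<le>m. inverse s ^ (m - r) * ?Q $$ (r, 0)) = s ^ m"
    unfolding delta_duality_sum[of m, symmetric] by (intro sum.cong) (auto simp: burau_duality_def)
  have d4: "(\<Sum>c\<le>m. inverse s ^ (m - c) * (if c = 0 then - 2 else 0)) = - 2 * inverse s ^ m"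
    by (subst sum.remove[of _ 0]) simp_all
  have d5: "s ^ m * (- 2 * inverse s ^ m) = - 2"
    by (simp add: power_inverse)
  have "Determinant.det (F * ?M) = (- 1) ^ ?n * (- 2 * corner_minor m M)"
    by (simp only: d1 d2 d3 d4 d5 corner_minor_transpose[OF M])
  then have det_FM: "Determinant.det (F * ?M) = 2 * (- 1) ^ m * corner_minor m M"
    by simp
  have "Determinant.det F * Determinant.det M = Determinant.det (F * ?M)"
    using det_mult[OF F M'] by (simp add: det_transpose[OF M])
  moreover have "Determinant.det M * Determinant.det W = 1"
    using det_mult[OF M W] by (simp add: MW)
  ultimately have "Determinant.det F = 2 * (- 1) ^ m * corner_minor m M * Determinant.det W"
    unfolding det_FM by (metis mult.assoc mult.right_neutral)
  then show ?thesis
    unfolding detE by (simp add: mult_ac)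
qed

lemma to_fract_power: "to_fract x ^ k = to_fract (x ^ k)"
  by (induction k) simp_all

lemma t_power_neq_one: "t ^ Suc m \<noteq> 1"
proof
  assume "t ^ Suc m = 1"
  then have "to_fract ([:0, 1:] ^ (2 * Suc m) :: complex poly) = to_fract 1"
    by (simp only: t_def s_def power_mult[symmetric] to_fract_power to_fract_1)
  then have "([:0, 1:] ^ (2 * Suc m) :: complex poly) = 1"
    by (simp only: to_fract_eq_iff)
  then have "poly ([:0, 1:] ^ (2 * Suc m) :: complex poly) 0 = poly 1 0"
    by (simp only:)
  then show False
    by simp
qed

text \<open>Let \<open>X\<close> be the upper left block of \<open>1 - M\<close> and \<open>d\<close> the truncation of \<open>\<delta>\<^sub>n\<close>. Passing to the quotient
  subtracts multiples of the last row, which is \<open>- d\<^sup>T X\<close>. So the matrix on the quotient is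
  \<open>(1 + d d\<^sup>T) X\<close>, and \<open>det(1 + d d\<^sup>T)\<close> is a geometric sum that cancels the normalising factor of the
  Alexander polynomial up to a power of \<open>t\<close>.\<close>

lemma alexander_eq_corner_minor:
  assumes M: "burau (Suc m) b \<in> carrier_mat (Suc m) (Suc m)"
    and left: "transpose_mat (burau (Suc m) b) *\<^sub>v delta (Suc m) = delta (Suc m)"
  shows "alexander_of_braid (Suc m) b = inverse t ^ m * corner_minor m (burau (Suc m) b)"
proof -
  define M where "M = burau (Suc m) b"
  let ?n = "Suc m" and ?w = "inverse s"
  let ?X = "Matrix.mat m m (\<lambda>(r, c). (1\<^sub>m ?n - M) $$ (r, c))"
  let ?J = "Matrix.mat m m (\<lambda>(r, c). (if r = c then 1 else 0) + ?w ^ (m - r) * ?w ^ (m - c))"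
  note M' = M[folded M_def]
  have P: "quot_proj ?n \<in> carrier_mat m ?n" and L: "quot_lift ?n \<in> carrier_mat ?n m"
    by (simp_all add: quot_proj_def quot_lift_def)
  have PM: "(quot_proj ?n * M) $$ (r, c) = M $$ (r, c) - ?w ^ (m - r) * M $$ (m, c)" if rc: "r < m" "c < ?n" for r c
  proof -
    have "(quot_proj ?n * M) $$ (r, c) = (\<Sum>l<?n. quot_proj ?n $$ (r, l) * M $$ (l, c))"
      by (rule mult_mat_index[OF P M' rc])
    also have "\<dots> = (\<Sum>l<m. quot_proj ?n $$ (r, l) * M $$ (l, c)) + quot_proj ?n $$ (r, m) * M $$ (m, c)"
      by simp
    also have "(\<Sum>l<m. quot_proj ?n $$ (r, l) * M $$ (l, c)) = (\<Sum>l<m. if l = r then M $$ (r, c) else 0)"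
      using rc by (intro sum.cong) (auto simp: quot_proj_def)
    finally show ?thesis using rc by (simp add: quot_proj_def)
  qed
  have quot: "burau_quot ?n b $$ (r, c) = M $$ (r, c) - ?w ^ (m - r) * M $$ (m, c)" if rc: "r < m" "c < m" for r c
  proof -
    have PMc: "quot_proj ?n * M \<in> carrier_mat m ?n" using P M' by simp
    have "burau_quot ?n b $$ (r, c) = (\<Sum>l<?n. (quot_proj ?n * M) $$ (r, l) * quot_lift ?n $$ (l, c))"
      unfolding burau_quot_def M_def[symmetric] by (rule mult_mat_index[OF PMc L rc])
    also have "\<dots> = (\<Sum>l<?n. if l = c then (quot_proj ?n * M) $$ (r, l) else 0)"
      using rc by (intro sum.cong) (auto simp: quot_lift_def)
    finally show ?thesis using rc PM[of r c] by simp
  qed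
  have qdim: "burau_quot ?n b \<in> carrier_mat m m"
    unfolding burau_quot_def M_def[symmetric] by (intro mult_carrier_mat[of _ m ?n] P L M')
  have last: "(1\<^sub>m ?n - M) $$ (m, c) = - (\<Sum>r<m. ?w ^ (m - r) * (1\<^sub>m ?n - M) $$ (r, c))" if "c < m" for c
    using delta_annihilates_one_minus[OF M' left[folded M_def], of c] that
    by (simp add: lessThan_Suc_atMost[symmetric] eq_neg_iff_add_eq_0 add.commute del: index_minus_mat)
  have "1\<^sub>m (?n - 1) - burau_quot ?n b = ?J * ?X"
  proof (rule eq_matI)
    fix r c assume "r < dim_row (?J * ?X)" "c < dim_col (?J * ?X)"
    then have rc: "r < m" "c < m" by simp_all
    have "(?J * ?X) $$ (r, c) = (\<Sum>l<m. ?J $$ (r, l) * ?X $$ (l, c))"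
      by (rule mult_mat_index[OF _ _ rc]) simp_all
    also have "\<dots> = (\<Sum>l<m. (if r = l then (1\<^sub>m ?n - M) $$ (l, c) else 0)
        + ?w ^ (m - r) * (?w ^ (m - l) * (1\<^sub>m ?n - M) $$ (l, c)))"
      using rc by (intro sum.cong) (simp_all add: algebra_simps del: index_minus_mat)
    also have "\<dots> = (1\<^sub>m ?n - M) $$ (r, c) - ?w ^ (m - r) * (1\<^sub>m ?n - M) $$ (m, c)"
      unfolding last[OF rc(2)] sum.distrib sum_distrib_left[symmetric]
      using rc by (simp del: index_minus_mat)
    finally show "(1\<^sub>m (?n - 1) - burau_quot ?n b) $$ (r, c) = (?J * ?X) $$ (r, c)"
      using rc M' qdim by (simp add: quot algebra_simps)
  qed (use qdim in simp_all)
  then have det: "Determinant.det (1\<^sub>m (?n - 1) - burau_quot ?n b) = Determinant.det ?J * Determinant.det ?X"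
    using det_mult[of ?J m ?X] by simp
  have "Determinant.det ?J = 1 + (\<Sum>i<m. ?w ^ (m - i) * ?w ^ (m - i))"
    by (rule det_one_plus_rank_one)
  also have "\<dots> = (\<Sum>i<?n. inverse t ^ (m - i))"
    by (simp add: inverse_t power_mult_distrib[symmetric] power2_eq_square)
  also have "\<dots> = (\<Sum>i<?n. inverse t ^ i)"
    using sum.nat_diff_reindex[of "\<lambda>i. inverse t ^ i" ?n] by simp
  also have "\<dots> = (\<Sum>i<?n. inverse t ^ m * t ^ (m - i))"
    by (intro sum.cong) (auto simp: power_inverse divide_inverse[symmetric] power_diff field_simps)
  also have "\<dots> = inverse t ^ m * (\<Sum>i<?n. t ^ i)"
    using sum.nat_diff_reindex[of "\<lambda>i. t ^ i" ?n] by (simp add: sum_distrib_left[symmetric])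
  finally have J: "Determinant.det ?J = inverse t ^ m * (\<Sum>i<?n. t ^ i)" .
  have "t \<noteq> 1" using t_power_neq_one[of 0] by simp
  then have geo: "(1 - t) / (1 - t ^ ?n) * (\<Sum>i<?n. t ^ i) = 1"
  proof -
    have eq: "1 - t ^ ?n = (1 - t) * (\<Sum>i<?n. t ^ i)"
      by (rule one_diff_power_eq)
    moreover have "(\<Sum>i<?n. t ^ i) \<noteq> 0"
      using t_power_neq_one[of m] eq by (metis eq_iff_diff_eq_0 mult_zero_right)
    ultimately show ?thesis
      using \<open>t \<noteq> 1\<close> by (simp only: eq) simp
  qed
  have "alexander_of_braid ?n b = ((1 - t) / (1 - t ^ ?n) * (\<Sum>i<?n. t ^ i)) * (inverse t ^ m * Determinant.det ?X)"
    unfolding alexander_of_braid_def det J by (simp only: mult_ac)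
  then show ?thesis
    unfolding geo corner_minor_def M_def by simp
qed

section \<open>Units of Laurent polynomial rings\<close>

interpretation const_hom: comm_ring_hom const
  by unfold_locales (simp_all add: const_def flip: to_fract_1 to_fract_add to_fract_mult)

interpretation map_const_hom: map_poly_comm_ring_hom const ..

lemma laurent_ringI: "x = poly (map_poly const p) y / y ^ k \<Longrightarrow> x \<in> laurent_ring y"
  unfolding laurent_ring_def by blast

lemma laurent_ring_mult:
  assumes "a \<in> laurent_ring x" "b \<in> laurent_ring x"
  shows "a * b \<in> laurent_ring x"
proof -
  obtain p k q l where "a = poly (map_poly const p) x / x ^ k" "b = poly (map_poly const q) x / x ^ l"
    using assms unfolding laurent_ring_def by blast
  then have "a * b = poly (map_poly const (p * q)) x / x ^ (k + l)"
    by (simp add: hom_distribs power_add)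
  then show ?thesis by (rule laurent_ringI)
qed

lemma laurent_unit_mult: "laurent_unit x u \<Longrightarrow> laurent_unit x v \<Longrightarrow> laurent_unit x (u * v)"
proof -
  assume "laurent_unit x u" "laurent_unit x v"
  then obtain u' v' where inv: "u \<in> laurent_ring x" "u' \<in> laurent_ring x" "u * u' = 1"
    "v \<in> laurent_ring x" "v' \<in> laurent_ring x" "v * v' = 1"
    unfolding laurent_unit_def by blast
  have "(u * v) * (u' * v') = (u * u') * (v * v')" by (simp only: mult_ac)
  then show ?thesis
    unfolding laurent_unit_def using inv laurent_ring_mult by (metis mult_1_left)
qed

lemma laurent_unit_one: "laurent_unit x 1"
  unfolding laurent_unit_def by (auto intro!: laurent_ringI[of _ 1 _ 0])

lemma laurent_unit_power: "laurent_unit x u \<Longrightarrow> laurent_unit x (u ^ k)"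
  by (induction k) (simp_all add: laurent_unit_one laurent_unit_mult)

lemma laurent_unit_inverse: "laurent_unit x u \<Longrightarrow> \<exists>v. laurent_unit x v \<and> u * v = 1"
  unfolding laurent_unit_def by (metis mult.commute)

text \<open>A polynomial in \<open>t = s\<^sup>2\<close> is a polynomial in \<open>s\<close>.\<close>

lemma laurent_ring_t_subset_s: "laurent_ring t \<subseteq> laurent_ring s"
proof
  fix a assume "a \<in> laurent_ring t"
  then obtain p k where a: "a = poly (map_poly const p) t / t ^ k"
    unfolding laurent_ring_def by blast
  have "poly (map_poly const [:0, 0, 1:]) s = t"
    by (simp add: t_def power2_eq_square)
  then have "a = poly (map_poly const (pcompose p [:0, 0, 1:])) s / s ^ (2 * k)"
    unfolding a by (simp only: const_hom.map_poly_pcompose poly_pcompose) (simp add: t_def power_mult)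
  then show "a \<in> laurent_ring s" by (rule laurent_ringI)
qed

lemma laurent_unit_t_s: "laurent_unit t u \<Longrightarrow> laurent_unit s u"
  using laurent_ring_t_subset_s unfolding laurent_unit_def by blast

lemma laurent_unit_variable:
  assumes "x \<noteq> 0"
  shows "laurent_unit x x"
proof -
  have "x \<in> laurent_ring x"
    by (rule laurent_ringI[of _ "[:0, 1:]" _ 0]) simp
  moreover have "inverse x \<in> laurent_ring x"
    by (rule laurent_ringI[of _ 1 _ 1]) (simp add: divide_inverse)
  ultimately show ?thesis
    unfolding laurent_unit_def using assms by (metis right_inverse)
qed

lemma t_monomials_unit: "x \<in> t_monomials \<Longrightarrow> laurent_unit t x"
proof -
  assume "x \<in> t_monomials"
  then obtain e j k where e: "e = 1 \<or> e = - 1" and x: "x = e * t ^ j / t ^ k"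
    unfolding t_monomials_def by blast
  have "laurent_unit t (- 1)"
    unfolding laurent_unit_def by (auto intro!: laurent_ringI[of _ "[:- 1:]" _ 0] bexI[of _ "- 1"] simp: const_hom.hom_uminus)
  then have "laurent_unit t e"
    using e laurent_unit_one by auto
  moreover have "laurent_unit t (inverse t)"
    using laurent_unit_inverse[OF laurent_unit_variable[OF t_nonzero]]
    by (metis inverse_unique)
  moreover have "x = e * (t ^ j * inverse t ^ k)"
    unfolding x by (simp add: divide_inverse power_inverse)
  ultimately show ?thesis
    by (simp add: laurent_unit_mult laurent_unit_power laurent_unit_variable)
qed

lemma two_nonzero: "(2 :: K) \<noteq> 0"
proof -
  have two: "to_fract (1 + 1 :: complex poly) = 2"
    by (subst to_fract_add) (simp only: to_fract_1 one_add_one)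
  have "to_fract (1 + 1 :: complex poly) \<noteq> 0"
    by (simp only: to_fract_eq_0_iff) simp
  then show ?thesis
    unfolding two .
qed

section \<open>The reduced Links-Gould invariant and the Alexander polynomial\<close>

text \<open>The factor \<open>1/8\<close> cancels the cube of the 2 in \<open>det_signed_dual\<close>, one factor 2 for each of the
  three exterior algebras.\<close>

lemma reduced_LG31_eq_alexander_cubed:
  assumes b: "is_braid n b"
  shows "\<exists>u\<in>t_monomials. reduced_LG31_of_braid n b = u * (s ^ (3 * (n - 1)) * alexander_of_braid n b ^ 3)"
proof -
  obtain m where n: "n = Suc m"
    using b unfolding is_braid_def by (cases n) auto
  let ?M = "burau n b" and ?N = "dual_burau n b"
  obtain W where W: "?M \<in> carrier_mat n n" "W \<in> carrier_mat n n" "?N \<in> carrier_mat n n"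
    "?M * W = 1\<^sub>m n" "Determinant.det W \<in> t_monomials"
    "?M *\<^sub>v delta n = delta n" "transpose_mat ?M *\<^sub>v delta n = delta n"
    "burau_duality n * ?N = transpose_mat W * burau_duality n"
    using burau_properties[OF b] by blast
  define \<epsilon> where "\<epsilon> = (- 1) ^ m * Determinant.det W"
  have \<epsilon>: "\<epsilon> \<in> t_monomials"
    unfolding \<epsilon>_def by (intro t_monomials_mult t_monomials_power t_monomials_basic W)
  have "alexander_of_braid n b = inverse t ^ m * corner_minor m ?M"
    using alexander_eq_corner_minor[of m b] W(1,7) unfolding n by simp
  then have cm: "corner_minor m ?M = t ^ m * alexander_of_braid n b"
    by (simp add: power_inverse)
  have "mat_trace (kron (1\<^sub>m 8) (kron_power mu (n - 1)) * S_rep n b)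
      = s ^ (3 * m) * (2 * (\<epsilon> * corner_minor m ?M)) ^ 3"
    using trace_three_exterior[of ?N m] det_signed_dual[of ?M m ?N W] W S_rep_eq_three_exterior[OF b]
    unfolding n \<epsilon>_def by simp
  then have "reduced_LG31_of_braid n b = 1 / 8 * (s ^ (3 * m) * (2 * (\<epsilon> * (t ^ m * alexander_of_braid n b))) ^ 3)"
    unfolding reduced_LG31_of_braid_def cm by simp
  also have "\<dots> = (1 / 8 * 2 ^ 3) * ((\<epsilon> * t ^ m) ^ 3 * (s ^ (3 * m) * alexander_of_braid n b ^ 3))"
    by (simp only: power_mult_distrib mult_ac)
  also have "1 / 8 * 2 ^ 3 = (1 :: K)"
  proof -
    have eight: "(2 :: K) ^ 3 = 8" by simp
    have "(2 :: K) ^ 3 \<noteq> 0"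
      by (rule power_not_zero[OF two_nonzero])
    then have "(8 :: K) \<noteq> 0" unfolding eight .
    then show ?thesis
      unfolding eight times_divide_eq_left mult_1_left by (rule divide_self)
  qed
  finally have "reduced_LG31_of_braid n b = (\<epsilon> * t ^ m) ^ 3 * (s ^ (3 * m) * alexander_of_braid n b ^ 3)"
    by simp
  moreover have "(\<epsilon> * t ^ m) ^ 3 \<in> t_monomials"
    by (intro t_monomials_power t_monomials_mult \<epsilon> t_monomials_basic)
  ultimately show ?thesis
    unfolding n by auto
qed

theorem theorem4p1:
  fixes L :: link
  assumes "oriented_link L"
  shows "(\<forall>p D. is_reduced_LG31 L p \<and> is_alexander_polynomial L D \<longrightarrow> doteq s p (D ^ 3)) \<and>
         (\<forall>n b. is_closure_of_braid L n b \<longrightarrow>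
            doteq t (reduced_LG31_of_braid n b) (s ^ (3 * (n - 1)) * alexander_of_braid n b ^ 3))"
proof (intro conjI allI impI)
  have unit: "\<exists>u. laurent_unit t u \<and> reduced_LG31_of_braid n b = u * (s ^ (3 * (n - 1)) * alexander_of_braid n b ^ 3)"
    if "is_closure_of_braid L n b" for n b
    using reduced_LG31_eq_alexander_cubed[of n b] that t_monomials_unit
    unfolding is_closure_of_braid_def by blast
  then show "doteq t (reduced_LG31_of_braid n b) (s ^ (3 * (n - 1)) * alexander_of_braid n b ^ 3)"
    if "is_closure_of_braid L n b" for n b
    using that unfolding doteq_def by blast
  fix p D
  assume "is_reduced_LG31 L p \<and> is_alexander_polynomial L D"
  then obtain n b where closure: "is_closure_of_braid L n b" and p: "p = reduced_LG31_of_braid n b"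
    and D: "doteq t D (alexander_of_braid n b)"
    unfolding is_reduced_LG31_def is_alexander_polynomial_def by blast
  obtain u where u: "laurent_unit t u" "p = u * (s ^ (3 * (n - 1)) * alexander_of_braid n b ^ 3)"
    using unit[OF closure] p by blast
  obtain v where v: "laurent_unit t v" "D = v * alexander_of_braid n b"
    using D unfolding doteq_def by blast
  obtain w where w: "laurent_unit t w" and vw: "v * w = 1"
    using laurent_unit_inverse[OF v(1)] by blast
  have alex: "alexander_of_braid n b = w * D"
    unfolding v(2) mult.assoc[symmetric] mult.commute[of w v] vw by simp
  have "p = (u * s ^ (3 * (n - 1)) * w ^ 3) * D ^ 3"
    unfolding u(2) alex by (simp only: power_mult_distrib mult_ac)
  moreover have "laurent_unit s (u * s ^ (3 * (n - 1)) * w ^ 3)"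
    using u(1) w
    by (intro laurent_unit_mult laurent_unit_power laurent_unit_variable laurent_unit_t_s) simp_all
  ultimately show "doteq s p (D ^ 3)"
    unfolding doteq_def by blast
qed

end
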